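(* Let $M\in\mathbb{R}^{n\times m}$ be a cost matrix, $a\in\Delta_n$, $b\in\Delta_m$ and $\lambda>0$. Let $$\mathcal L_{a,b}(\alpha,\beta)=\alpha^\top a+\beta^\top b-\frac1\lambda\sum_{i=1}^{n}\sum_{j=1}^{m}e^{-\lambda(M_{ij}-\alpha_i-\beta_j)},\qquad \alpha\in\mathbb{R}^n,\ \beta\in\mathbb{R}^m,\ \beta_m=0,$$ regarded as a function of the $n+m-1$ free variables $(\alpha_1,\dots,\alpha_n,\beta_1,\dots,\beta_{m-1})$, with argmax in $(\alpha_*,\beta_* )$, and let $$T_\lambda=\mathrm{diag}(e^{\lambda\alpha_*})\,e^{-\lambda M}\,\mathrm{diag}(e^{\lambda\beta_*}),$$ with exponentials taken entrywise. Then $$\nabla_a \mathrm S_\lambda(a,b)=\mathsf P_{\mathrm T\Delta_n}\big(A\,L\,\mathbf 1_m+B\,\bar L^\top\mathbf 1_n\big),$$ where $L=T_\lambda\odot M\in\mathbb{R}^{n\times m}$ is the entrywise product of $T_\lambda$ and $M$, $\bar L\in\mathbb{R}^{n\times(m-1)}$ is $L$ with the last column removed, and $A\in\mathbb{R}^{n\times n}$, $B\in\mathbb{R}^{n\times(m-1)}$ are given by $$[A\ \ B]=-\lambda\,D\,\big[\nabla^2_{(\alpha,\beta)}\mathcal L_{a,b}(\alpha_*,\beta_* )\big]^{-1},$$ with $D=[\mathrm I\ \ \mathbf 0]\in\mathbb{R}^{n\times(n+m-1)}$ the concatenation of the $n\times n$ identity matrix and the zero matrix in $\mathbb{R}^{n\times(m-1)}$.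 Here $\mathsf P_{\mathrm T\Delta_n}$ is the orthogonal projection of $\mathbb{R}^n$ onto the tangent space $\mathrm T\Delta_n=\{x\in\mathbb{R}^n:\sum_{i=1}^n x_i=0\}$ of the simplex $\Delta_n$.
   Context: $\Delta_n=\{p\in\mathbb{R}^n : p_i\ge0,\ \sum_i p_i=1\}$; $\mathbf 1_n$ is the all-ones vector in $\mathbb{R}^n$; $\mathrm{diag}(v)$ is the diagonal matrix with diagonal $v$. For $a\in\Delta_n$, $b\in\Delta_m$, let $\Pi(a,b)=\{T\in\mathbb{R}^{n\times m}: T_{ij}\ge0,\ T\mathbf 1_m=a,\ T^\top\mathbf 1_n=b\}$, $\langle T,M\rangle=\mathrm{Tr}(T^\top M)$, and $h(T)=-\sum_{i,j}T_{ij}(\log T_{ij}-1)$ (with $0\log0=0$). The sharp Sinkhorn distance is $\mathrm S_\lambda(a,b)=\langle T,M\rangle$ where $T$ is the unique minimizer over $\Pi(a,b)$ of $\langle T,M\rangle-\frac1\lambda h(T)$; by Sinkhorn's scaling theorem this minimizer is the matrix $T_\lambda$ of the claim, built from the maximizer of the dual function $\mathcal L_{a,b}$. $\nabla_a\mathrm S_\lambda(a,b)$ is the gradient of $a\mapsto\mathrm S_\lambda(a,b)$ as a function on the simplex: the unique vector $g\in\mathrm T\Delta_n$ such that the derivative of $\mathrm S_\lambda(\cdot,b)$ at $a$ in every direction $v\in\mathrm T\Delta_n$ equals $g^\top v$. *)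

theory Defs
  imports "HOL-Analysis.Derivative" "Jordan_Normal_Form.Gauss_Jordan_Elimination"
begin

unbundle no inner_syntax

text \<open>Vectors and matrices have explicit dimensions in \<open>nat\<close> (\<open>carrier_vec\<close>, \<open>carrier_mat\<close>) and
  0-based indices, so that blocks of width \<open>m - 1\<close> are available for every \<open>m \<ge> 1\<close>.\<close>

definition ones_vec :: "nat \<Rightarrow> real Matrix.vec" where
  "ones_vec n = Matrix.vec n (\<lambda>_. 1)"

definition prob_simplex :: "nat \<Rightarrow> real Matrix.vec set" where
  "prob_simplex n = {p \<in> carrier_vec n. (\<forall>i<n. 0 \<le> vec_index p i) \<and> (\<Sum>i<n. vec_index p i) = 1}"

definition tangent_simplex :: "nat \<Rightarrow> real Matrix.vec set" where
  "tangent_simplex n = {x \<in> carrier_vec n. (\<Sum>i<n. vec_index x i) = 0}"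

text \<open>For a linear subspace \<open>W\<close>, \<open>orth_proj W x\<close> is the point of \<open>W\<close> whose difference to \<open>x\<close>
  is orthogonal to \<open>W\<close>.\<close>

definition orth_proj :: "real Matrix.vec set \<Rightarrow> real Matrix.vec \<Rightarrow> real Matrix.vec" where
  "orth_proj W x = (THE y. y \<in> W \<and> (\<forall>w\<in>W. (x - y) \<bullet> w = 0))"


definition hadamard :: "real mat \<Rightarrow> real mat \<Rightarrow> real mat" where
  "hadamard A B = Matrix.mat (dim_row A) (dim_col A) (\<lambda>(i, j). A $$ (i, j) * B $$ (i, j))"

definition drop_last_col :: "real mat \<Rightarrow> real mat" where
  "drop_last_col A = Matrix.mat (dim_row A) (dim_col A - 1) (\<lambda>(i, j). A $$ (i, j))"

definition append_cols :: "real mat \<Rightarrow> real mat \<Rightarrow> real mat" where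
  "append_cols A B = four_block_mat A B (0\<^sub>m 0 (dim_col A)) (0\<^sub>m 0 (dim_col B))"

definition mat_trace :: "real mat \<Rightarrow> real" where
  "mat_trace A = (\<Sum>i<dim_row A. A $$ (i, i))"

definition mat_inner :: "real mat \<Rightarrow> real mat \<Rightarrow> real" where
  "mat_inner T M = mat_trace (T\<^sup>T * M)"


definition transport_polytope :: "real Matrix.vec \<Rightarrow> real Matrix.vec \<Rightarrow> real mat set" where
  "transport_polytope a b =
     {T \<in> carrier_mat (dim_vec a) (dim_vec b).
        (\<forall>i<dim_vec a. \<forall>j<dim_vec b. 0 \<le> T $$ (i, j)) \<and>
        T *\<^sub>v ones_vec (dim_vec b) = a \<and> T\<^sup>T *\<^sub>v ones_vec (dim_vec a) = b}"

text \<open>\<open>0 * (ln 0 - 1) = 0\<close>, which is the convention \<open>0 log 0 = 0\<close>.\<close>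

definition entropy :: "real mat \<Rightarrow> real" where
  "entropy T = - (\<Sum>i<dim_row T. \<Sum>j<dim_col T. T $$ (i, j) * (ln (T $$ (i, j)) - 1))"

definition sinkhorn_plan :: "real \<Rightarrow> real mat \<Rightarrow> real Matrix.vec \<Rightarrow> real Matrix.vec \<Rightarrow> real mat" where
  "sinkhorn_plan lam M a b =
     (THE T. is_arg_min (\<lambda>T. mat_inner T M - 1 / lam * entropy T) (\<lambda>T. T \<in> transport_polytope a b) T)"

definition sharp_sinkhorn :: "real \<Rightarrow> real mat \<Rightarrow> real Matrix.vec \<Rightarrow> real Matrix.vec \<Rightarrow> real" where
  "sharp_sinkhorn lam M a b = mat_inner (sinkhorn_plan lam M a b) M"


definition dual_fun ::
  "real \<Rightarrow> real mat \<Rightarrow> real Matrix.vec \<Rightarrow> real Matrix.vec \<Rightarrow> real Matrix.vec \<Rightarrow> real Matrix.vec \<Rightarrow> real" where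
  "dual_fun lam M a b \<alpha> \<beta> =
     \<alpha> \<bullet> a + \<beta> \<bullet> b -
     1 / lam * (\<Sum>i<dim_vec a. \<Sum>j<dim_vec b.
       exp (- lam * (M $$ (i, j) - vec_index \<alpha> i - vec_index \<beta> j)))"

text \<open>The dual variables with \<open>\<beta>\<^sub>m = 0\<close>, and the passage between such a pair and the vector
  \<open>(\<alpha>\<^sub>1, \<dots>, \<alpha>\<^sub>n, \<beta>\<^sub>1, \<dots>, \<beta>\<^sub>m\<^sub>-\<^sub>1)\<close> of the free variables.\<close>

definition dual_vars :: "nat \<Rightarrow> nat \<Rightarrow> (real Matrix.vec \<times> real Matrix.vec) set" where
  "dual_vars n m = {(\<alpha>, \<beta>). \<alpha> \<in> carrier_vec n \<and> \<beta> \<in> carrier_vec m \<and> vec_index \<beta> (m - 1) = 0}"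

definition free_vars :: "real Matrix.vec \<Rightarrow> real Matrix.vec \<Rightarrow> real Matrix.vec" where
  "free_vars \<alpha> \<beta> = \<alpha> @\<^sub>v vec_first \<beta> (dim_vec \<beta> - 1)"

definition dual_fun_free ::
  "real \<Rightarrow> real mat \<Rightarrow> real Matrix.vec \<Rightarrow> real Matrix.vec \<Rightarrow> real Matrix.vec \<Rightarrow> real" where
  "dual_fun_free lam M a b z =
     dual_fun lam M a b (vec_first z (dim_vec a)) (vec_last z (dim_vec b - 1) @\<^sub>v 0\<^sub>v 1)"

definition scaled_kernel :: "real \<Rightarrow> real mat \<Rightarrow> real Matrix.vec \<Rightarrow> real Matrix.vec \<Rightarrow> real mat" where
  "scaled_kernel lam M \<alpha> \<beta> =
     mat_diag (dim_vec \<alpha>) (\<lambda>i. exp (lam * vec_index \<alpha> i)) *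
     map_mat (\<lambda>x. exp (- lam * x)) M *
     mat_diag (dim_vec \<beta>) (\<lambda>j. exp (lam * vec_index \<beta> j))"


definition partial_deriv :: "nat \<Rightarrow> (real Matrix.vec \<Rightarrow> real) \<Rightarrow> real Matrix.vec \<Rightarrow> real" where
  "partial_deriv i f z = deriv (\<lambda>t. f (z + t \<cdot>\<^sub>v unit_vec (dim_vec z) i)) 0"

definition hessian :: "(real Matrix.vec \<Rightarrow> real) \<Rightarrow> real Matrix.vec \<Rightarrow> real mat" where
  "hessian f z =
     Matrix.mat (dim_vec z) (dim_vec z) (\<lambda>(i, j). partial_deriv i (partial_deriv j f) z)"

text \<open>\<open>g\<close> is the gradient at \<open>a\<close> of \<open>f\<close> as a function on the simplex. If all coordinates of \<open>a\<close> are
  positive, then \<open>a + t v\<close> stays in the simplex for all small \<open>t\<close>, so only values of \<open>f\<close> on the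
  simplex matter.\<close>

definition has_simplex_gradient ::
  "(real Matrix.vec \<Rightarrow> real) \<Rightarrow> real Matrix.vec \<Rightarrow> real Matrix.vec \<Rightarrow> bool" where
  "has_simplex_gradient f a g \<longleftrightarrow>
     g \<in> tangent_simplex (dim_vec a) \<and>
     (\<forall>v\<in>tangent_simplex (dim_vec a).
        ((\<lambda>t. f (a + t \<cdot>\<^sub>v v)) has_real_derivative g \<bullet> v) (at 0))"

lemma has_simplex_gradient_unique:
  assumes "has_simplex_gradient f a g" "has_simplex_gradient f a g'"
  shows "g = g'"
proof -
  let ?n = "dim_vec a"
  have c: "g \<in> carrier_vec ?n" "g' \<in> carrier_vec ?n"
    using assms by (auto simp: has_simplex_gradient_def tangent_simplex_def)
  have v: "g - g' \<in> tangent_simplex ?n"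
    using assms by (auto simp: has_simplex_gradient_def tangent_simplex_def sum_subtractf)
  have "g \<bullet> (g - g') = g' \<bullet> (g - g')"
    using assms v DERIV_unique unfolding has_simplex_gradient_def by blast
  hence "(g - g') \<bullet> (g - g') = 0"
    using c by (simp add: minus_scalar_prod_distrib[of _ ?n])
  hence "(\<Sum>i<?n. (vec_index g i - vec_index g' i)\<^sup>2) = 0"
    using c by (simp add: scalar_prod_def power2_eq_square lessThan_atLeast0)
  hence "\<forall>i<?n. vec_index g i = vec_index g' i"
    by (subst (asm) sum_nonneg_eq_0_iff) auto
  thus ?thesis
    using c by auto
qed

end

theory Submission
  imports Defs "Jordan_Normal_Form.Determinant"
begin

text \<open>
  The dual maximizer \<open>z\<close> is a critical point, so \<open>T\<^sub>\<lambda>\<close> has marginals \<open>a\<close> and \<open>b\<close>; in particular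
  \<open>a > 0\<close>. The dual Hessian is \<open>- \<lambda> \<Sum>\<^sub>i\<^sub>j T\<^sub>i\<^sub>j e\<^sub>i\<^sub>j e\<^sub>i\<^sub>j\<^sup>T\<close>, where \<open>e\<^sub>i\<^sub>j\<close> represents the functional
  \<open>z \<mapsto> \<alpha>\<^sub>i + \<beta>\<^sub>j\<close>, hence negative definite and invertible.

  The implicit function theorem is avoided. Given a tangent vector \<open>v\<close>, move the dual variables
  linearly along the solution \<open>w\<close> of \<open>H w = - (v, 0)\<close>. The resulting Gibbs kernels \<open>Y\<^sub>t\<close> have marginals
  \<open>(a + t v, b)\<close> up to \<open>o(t)\<close>, and a correction \<open>R\<^sub>t = o(t)\<close> restores them exactly. Among couplings with
  fixed marginals, the regularized cost is the relative entropy with respect to \<open>Y\<^sub>t\<close> up to constants.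
  As the optimal plan \<open>P\<^sub>t\<close> is no worse than \<open>Y\<^sub>t + R\<^sub>t\<close>, quadratic upper and lower bounds for the
  relative entropy give \<open>|P\<^sub>t - Y\<^sub>t| = O(|R\<^sub>t|) = o(t)\<close>: the plan has the same derivative as \<open>Y\<^sub>t\<close>.
\<close>

subsection \<open>Relative entropy\<close>

text \<open>Integrand of the generalized Kullback-Leibler divergence, for unnormalized masses. The
  logarithms are kept apart so that \<open>ln y\<close> is affine in the potentials for Gibbs
  \<open>y\<close>; as \<open>ln 0 = 0\<close>, the value at \<open>x = 0\<close> is
  \<open>y\<close>.\<close>

definition rel_ent :: "real \<Rightarrow> real \<Rightarrow> real" where
  "rel_ent x y = x * ln x - x * ln y - x + y"

text \<open>The chi-square bound, from \<open>ln u \<le> u - 1\<close> at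
  \<open>u = x / y\<close>.\<close>

lemma rel_ent_upper:
  assumes "x > 0" "y > 0"
  shows "rel_ent x y \<le> (x - y)\<^sup>2 / y"
proof -
  have "ln (x / y) \<le> x / y - 1"
    using assms by (intro ln_le_minus_one) simp
  hence "x * (ln x - ln y) \<le> x * (x / y - 1)"
    using assms by (intro mult_left_mono) (auto simp: ln_div)
  thus ?thesis
    using assms by (simp add: rel_ent_def field_simps power2_eq_square)
qed

text \<open>The squared Hellinger bound, from \<open>ln u \<le> u - 1\<close> at
  \<open>u = sqrt (y / x)\<close>.\<close>

lemma rel_ent_lower:
  assumes "x \<ge> 0" "y > 0"
  shows "(sqrt x - sqrt y)\<^sup>2 \<le> rel_ent x y"
proof (cases "x = 0")
  case False
  with assms have x: "x > 0" by simp
  have "ln (sqrt (y / x)) \<le> sqrt (y / x) - 1"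
    using assms x by (intro ln_le_minus_one) simp
  moreover have "ln (sqrt (y / x)) = (ln y - ln x) / 2"
    using assms x by (simp add: ln_sqrt ln_div)
  ultimately have "x * (ln y - ln x) \<le> x * (2 * sqrt (y / x) - 2)"
    using x by (intro mult_left_mono) auto
  moreover have "x * sqrt (y / x) = sqrt x * sqrt y"
    using x by (simp add: real_sqrt_divide real_div_sqrt field_simps)
  ultimately show ?thesis
    using assms by (simp add: rel_ent_def power2_diff algebra_simps)
qed (use assms in \<open>simp add: rel_ent_def\<close>)

lemma rel_ent_nonneg: "x \<ge> 0 \<Longrightarrow> y > 0 \<Longrightarrow> 0 \<le> rel_ent x y"
  by (rule order_trans[OF _ rel_ent_lower]) auto

lemma rel_ent_pos: "x \<ge> 0 \<Longrightarrow> y > 0 \<Longrightarrow> x \<noteq> y \<Longrightarrow> 0 < rel_ent x y"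
  by (rule less_le_trans[OF _ rel_ent_lower]) auto

lemma square_diff_le_rel_ent:
  assumes "0 \<le> x" "x \<le> 1" "0 < y" "y \<le> 2"
  shows "(x - y)\<^sup>2 \<le> 6 * rel_ent x y"
proof -
  \<comment> \<open>The constant 6 is \<open>2 * (1 + 2)\<close>, from the upper bounds on
    \<open>x\<close> and \<open>y\<close>.\<close>
  have "(sqrt x + sqrt y)\<^sup>2 \<le> 2 * (x + y)"
    using assms sum_squares_bound[of "sqrt x" "sqrt y"] by (simp add: power2_sum)
  hence s: "(sqrt x + sqrt y)\<^sup>2 \<le> 6"
    using assms by simp
  have "x - y = (sqrt x + sqrt y) * (sqrt x - sqrt y)"
    using assms by (simp add: algebra_simps)
  hence "(x - y)\<^sup>2 = (sqrt x + sqrt y)\<^sup>2 * (sqrt x - sqrt y)\<^sup>2"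
    by (simp add: power_mult_distrib)
  also have "\<dots> \<le> 6 * rel_ent x y"
    using assms s by (intro mult_mono rel_ent_lower) auto
  finally show ?thesis .
qed

text \<open>At \<open>l = 0\<close>, where \<open>ln\<close> is not continuous,
  \<open>x * ln x\<close> is squeezed by a bound that vanishes at 0. This covers couplings with zero
  entries.\<close>

lemma tendsto_mult_ln:
  fixes f :: "'a \<Rightarrow> real"
  assumes "(f \<longlongrightarrow> l) F" "\<And>x. 0 \<le> f x"
  shows "((\<lambda>x. f x * ln (f x)) \<longlongrightarrow> l * ln l) F"
proof (cases "l = 0")
  case False
  thus ?thesis using assms by (intro tendsto_intros) auto
next
  case True
  have bound: "\<bar>x * ln x\<bar> \<le> 2 * sqrt x + x\<^sup>2" if "x \<ge> 0" for x :: real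
  proof (cases "x = 0")
    case False
    with that have x: "x > 0" by simp
    \<comment> \<open>With \<open>y = sqrt x\<close>, half of \<open>x * ln x\<close> survives in
      \<open>rel_ent\<close>, so nonnegativity bounds \<open>x * ln x\<close> from below.\<close>
    have "0 \<le> rel_ent x (sqrt x)"
      using x by (intro rel_ent_nonneg) auto
    hence "- (x * ln x) \<le> 2 * sqrt x"
      using x by (simp add: rel_ent_def ln_sqrt)
    moreover have "x * ln x \<le> x * x"
      using x ln_le_minus_one[OF x] by (intro mult_left_mono) auto
    moreover have "0 \<le> x * x" "0 \<le> sqrt x"
      using x by simp_all
    ultimately show ?thesis
      unfolding power2_eq_square by linarith
  qed simp
  have "((\<lambda>x. 2 * sqrt (f x) + (f x)\<^sup>2) \<longlongrightarrow> 2 * sqrt 0 + 0\<^sup>2) F"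
    by (rule tendsto_add[OF tendsto_mult[OF tendsto_const tendsto_real_sqrt] tendsto_power])
      (use assms(1) True in simp_all)
  hence "((\<lambda>x. 2 * sqrt (f x) + (f x)\<^sup>2) \<longlongrightarrow> 0) F"
    by simp
  hence "((\<lambda>x. f x * ln (f x)) \<longlongrightarrow> 0) F"
    by (rule Lim_null_comparison[rotated]) (use assms(2) bound in simp)
  thus ?thesis using True by simp
qed

subsection \<open>Entropic optimal transport\<close>

text \<open>Transport plans as plain functions: perturbed plans can be written pointwise, and values
  outside the \<open>n\<close> by \<open>m\<close> range do not matter.\<close>

definition coupling ::
  "nat \<Rightarrow> nat \<Rightarrow> (nat \<Rightarrow> real) \<Rightarrow> (nat \<Rightarrow> real) \<Rightarrow> (nat \<Rightarrow> nat \<Rightarrow> real) \<Rightarrow> bool" where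
  "coupling n m a b X \<longleftrightarrow> (\<forall>i<n. \<forall>j<m. 0 \<le> X i j) \<and>
     (\<forall>i<n. (\<Sum>j<m. X i j) = a i) \<and> (\<forall>j<m. (\<Sum>i<n. X i j) = b j)"

definition reg_cost ::
  "nat \<Rightarrow> nat \<Rightarrow> real \<Rightarrow> (nat \<Rightarrow> nat \<Rightarrow> real) \<Rightarrow> (nat \<Rightarrow> nat \<Rightarrow> real) \<Rightarrow> real" where
  "reg_cost n m lam M X =
     (\<Sum>i<n. \<Sum>j<m. X i j * M i j + 1 / lam * (X i j * (ln (X i j) - 1)))"

lemma coupling_le_marginal:
  assumes "coupling n m a b X" "i < n" "j < m"
  shows "X i j \<le> a i"
proof -
  have "X i j \<le> (\<Sum>j<m. X i j)"
    using assms by (intro member_le_sum) (auto simp: coupling_def)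
  thus ?thesis using assms by (simp add: coupling_def)
qed

lemma coupling_le_col_marginal:
  assumes "coupling n m a b X" "i < n" "j < m"
  shows "X i j \<le> b j"
proof -
  have "X i j \<le> (\<Sum>i<n. X i j)"
    using assms by (intro member_le_sum[of i "{..<n}" "\<lambda>i. X i j"]) (auto simp: coupling_def)
  thus ?thesis using assms by (simp add: coupling_def)
qed

section \<open>Compactness of the couplings and existence of a minimizer\<close>

lemma reg_cost_tendsto:
  assumes "\<And>i j. i < n \<Longrightarrow> j < m \<Longrightarrow> ((\<lambda>k. X k i j) \<longlongrightarrow> Y i j) F"
    and "\<And>k i j. i < n \<Longrightarrow> j < m \<Longrightarrow> 0 \<le> X k i j"
  shows "((\<lambda>k. reg_cost n m lam M (X k)) \<longlongrightarrow> reg_cost n m lam M Y) F"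
proof -
  have "reg_cost n m lam M Z = (\<Sum>i<n. \<Sum>j<m. Z i j * M i j +
      1 / lam * (Z i j * ln (Z i j) - Z i j))" for Z
    by (simp add: reg_cost_def algebra_simps)
  moreover have "((\<lambda>k. \<Sum>i<n. \<Sum>j<m. X k i j * M i j + 1 / lam * (X k i j * ln (X k i j) - X k i j))
     \<longlongrightarrow> (\<Sum>i<n. \<Sum>j<m. Y i j * M i j + 1 / lam * (Y i j * ln (Y i j) - Y i j))) F"
    using assms by (intro tendsto_intros tendsto_mult_ln) auto
  ultimately show ?thesis by simp
qed

lemma coupling_limit:
  assumes "\<And>i j. i < n \<Longrightarrow> j < m \<Longrightarrow> (\<lambda>k. X k i j) \<longlonglongrightarrow> Y i j"
    and X: "\<And>k :: nat. coupling n m a b (X k)"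
  shows "coupling n m a b Y"
  unfolding coupling_def
proof (intro conjI allI impI)
  show "0 \<le> Y i j" if "i < n" "j < m" for i j
    using assms(1)[OF that] X that
    by (intro LIMSEQ_le_const[of _ _ 0]) (auto simp: coupling_def)
  show "(\<Sum>j<m. Y i j) = a i" if "i < n" for i
  proof -
    have "(\<lambda>k. \<Sum>j<m. X k i j) \<longlonglongrightarrow> (\<Sum>j<m. Y i j)"
      using assms that by (intro tendsto_intros) auto
    thus ?thesis using X that by (simp add: coupling_def LIMSEQ_const_iff)
  qed
  show "(\<Sum>i<n. Y i j) = b j" if "j < m" for j
  proof -
    have "(\<lambda>k. \<Sum>i<n. X k i j) \<longlonglongrightarrow> (\<Sum>i<n. Y i j)"
      using assms that by (intro tendsto_intros) auto
    thus ?thesis using X that by (simp add: coupling_def LIMSEQ_const_iff)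
  qed
qed

text \<open>Each entry lies in \<open>[0, a i]\<close>, so Bolzano-Weierstrass applies to the
  finitely many index pairs.\<close>

lemma coupling_sequentially_compact:
  assumes "\<And>k :: nat. coupling n m a b (X k)"
  obtains Y and r :: "nat \<Rightarrow> nat" where "strict_mono r"
    "\<And>i j. i < n \<Longrightarrow> j < m \<Longrightarrow> (\<lambda>k. X (r k) i j) \<longlonglongrightarrow> Y i j"
proof -
  let ?I = "{..<n} \<times> {..<m}"
  let ?f = "\<lambda>k ij. X k (fst ij) (snd ij)"
  have bd: "bounded ((\<lambda>x. x k) ` range ?f)" if k: "k \<in> ?I" for k
    unfolding bounded_iff
  proof (intro exI ballI)
    fix x assume "x \<in> (\<lambda>x. x k) ` range ?f"
    then obtain l where x: "x = X l (fst k) (snd k)" by auto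
    have "0 \<le> x" "x \<le> a (fst k)"
      using assms[of l] k coupling_le_marginal[OF assms[of l]] unfolding x
      by (auto simp: coupling_def)
    thus "norm x \<le> a (fst k)" by simp
  qed
  have "\<forall>d\<subseteq>?I. \<exists>(l :: nat \<times> nat \<Rightarrow> real) (r :: nat \<Rightarrow> nat). strict_mono r \<and>
      (\<forall>e>0. \<forall>\<^sub>F k in sequentially. \<forall>i\<in>d. dist (?f (r k) i) (l i) < e)"
    by (rule compact_lemma_general[where unproj = "\<lambda>x. x" and basis = ?I]) (use bd in auto)
  from this[rule_format, OF subset_refl]
  obtain l :: "nat \<times> nat \<Rightarrow> real" and r :: "nat \<Rightarrow> nat" where r: "strict_mono r"
    and l: "\<And>e. e > 0 \<Longrightarrow>
      eventually (\<lambda>k. \<forall>i\<in>?I. dist (?f (r k) i) (l i) < e) sequentially"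
    by blast
  show ?thesis
  proof (rule that[of r "\<lambda>i j. l (i, j)"])
    fix i j assume ij: "i < n" "j < m"
    show "(\<lambda>k. X (r k) i j) \<longlonglongrightarrow> l (i, j)"
    proof (rule tendstoI)
      fix e :: real assume "e > 0"
      from l[OF this] show "\<forall>\<^sub>F k in sequentially. dist (X (r k) i j) (l (i, j)) < e"
        by (rule eventually_mono) (use ij in force)
    qed
  qed (use r in auto)
qed

text \<open>The direct method: a subsequence of a minimizing sequence converges to a coupling, and
  the cost is continuous along it.\<close>

lemma reg_cost_minimizer_exists:
  assumes "coupling n m a b X0"
  obtains Y where "coupling n m a b Y"
    "\<And>X. coupling n m a b X \<Longrightarrow> reg_cost n m lam M Y \<le> reg_cost n m lam M X"
proof -
  let ?C = "{X. coupling n m a b X}"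
  let ?E = "reg_cost n m lam M"
  let ?S = "Inf (ereal ` ?E ` ?C)"
  \<comment> \<open>The infimum is taken in the extended reals, so no lower bound on the cost has to
    be known beforehand; it is finite because the limit \<open>Y\<close> attains it.\<close>
  have "ereal ` ?E ` ?C \<noteq> {}" using assms by auto
  from Inf_as_limit[OF this] obtain u where u: "\<And>k. u k \<in> ereal ` ?E ` ?C" "u \<longlonglongrightarrow> ?S"
    by blast
  have "\<exists>x. coupling n m a b x \<and> u k = ereal (?E x)" for k
    using u(1)[of k] by auto
  then obtain X where X: "\<And>k. coupling n m a b (X k)" "\<And>k. u k = ereal (?E (X k))"
    by metis
  obtain Y and r :: "nat \<Rightarrow> nat" where r: "strict_mono r"
    and Y: "\<And>i j. i < n \<Longrightarrow> j < m \<Longrightarrow> (\<lambda>k. X (r k) i j) \<longlonglongrightarrow> Y i j"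
    by (rule coupling_sequentially_compact[of n m a b X]) (use X in auto)
  have "(\<lambda>k. ?E (X (r k))) \<longlonglongrightarrow> ?E Y"
    using Y X by (intro reg_cost_tendsto) (auto simp: coupling_def)
  hence "(\<lambda>k. u (r k)) \<longlonglongrightarrow> ereal (?E Y)"
    using X by simp
  hence "ereal (?E Y) = ?S"
    using LIMSEQ_subseq_LIMSEQ[OF u(2) r] LIMSEQ_unique by (auto simp: o_def)
  moreover have "?S \<le> ereal (?E Z)" if "coupling n m a b Z" for Z
    using that by (intro Inf_lower) auto
  ultimately have "?E Y \<le> ?E Z" if "coupling n m a b Z" for Z
    using that by (metis ereal_less_eq(3))
  moreover have "coupling n m a b Y"
    by (rule coupling_limit[OF Y X(1)])
  ultimately show ?thesis using that by blast
qed

section \<open>Strict convexity and uniqueness of the minimizer\<close>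

text \<open>The convexity gap of \<open>x * ln x\<close> at the midpoint equals the sum of the
  relative entropies of \<open>x\<close> and \<open>y\<close> with respect to it.\<close>

lemma entropy_midpoint_strict:
  assumes "x \<ge> 0" "y \<ge> 0" "x \<noteq> (y :: real)"
  shows "2 * ((x + y) / 2 * ln ((x + y) / 2)) < x * ln x + y * ln y"
proof -
  have "0 < rel_ent x ((x + y) / 2)" "0 \<le> rel_ent y ((x + y) / 2)"
    using assms by (auto intro!: rel_ent_pos rel_ent_nonneg)
  hence "0 < rel_ent x ((x + y) / 2) + rel_ent y ((x + y) / 2)" by simp
  also have "\<dots> = x * ln x + y * ln y - 2 * ((x + y) / 2 * ln ((x + y) / 2))"
    by (simp add: rel_ent_def field_simps)
  finally show ?thesis by simp
qed

text \<open>If two minimizers differed in one entry, their midpoint would be a strictly cheaper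
  coupling.\<close>

lemma reg_cost_minimizer_unique:
  assumes lam: "lam > 0" and X: "coupling n m a b X" and Y: "coupling n m a b Y"
    and min: "\<And>Z. coupling n m a b Z \<Longrightarrow> reg_cost n m lam M X \<le> reg_cost n m lam M Z"
      "reg_cost n m lam M Y \<le> reg_cost n m lam M X"
    and i: "i < n" and j: "j < m"
  shows "X i j = Y i j"
proof (rule ccontr)
  assume ne: "X i j \<noteq> Y i j"
  let ?Z = "\<lambda>i j. (X i j + Y i j) / 2"
  let ?c = "\<lambda>i j x. x * M i j + 1 / lam * (x * (ln x - 1))"
  have Z: "coupling n m a b ?Z"
    using X Y by (auto simp: coupling_def sum.distrib simp flip: sum_divide_distrib)
  have strict: "2 * ?c i j (?Z i j) < ?c i j (X i j) + ?c i j (Y i j)"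
    if "i < n" "j < m" "X i j \<noteq> Y i j" for i j
  proof -
    have "2 * (?Z i j * ln (?Z i j)) < X i j * ln (X i j) + Y i j * ln (Y i j)"
      using X Y that by (intro entropy_midpoint_strict) (auto simp: coupling_def)
    hence "1 / lam * (2 * (?Z i j * ln (?Z i j))) < 1 / lam * (X i j * ln (X i j) + Y i j * ln (Y i j))"
      using lam by (intro mult_strict_left_mono) auto
    thus ?thesis by (simp add: algebra_simps add_divide_distrib)
  qed
  have weak: "2 * ?c i j (?Z i j) \<le> ?c i j (X i j) + ?c i j (Y i j)"
    if "i < n" "j < m" for i j
    using strict[OF that] by (cases "X i j = Y i j") auto
  have "2 * reg_cost n m lam M ?Z = (\<Sum>i<n. \<Sum>j<m. 2 * ?c i j (?Z i j))"
    unfolding reg_cost_def sum_distrib_left ..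
  also have "\<dots> < (\<Sum>i<n. \<Sum>j<m. ?c i j (X i j) + ?c i j (Y i j))"
  proof (rule sum_strict_mono_ex1)
    show "\<forall>i\<in>{..<n}. (\<Sum>j<m. 2 * ?c i j (?Z i j)) \<le> (\<Sum>j<m. ?c i j (X i j) + ?c i j (Y i j))"
      using weak by (intro ballI sum_mono) auto
    have "(\<Sum>j<m. 2 * ?c i j (?Z i j)) < (\<Sum>j<m. ?c i j (X i j) + ?c i j (Y i j))"
      by (rule sum_strict_mono_ex1[OF _ _ bexI[of _ j]])
        (use weak[OF i] strict[OF i j ne] j in \<open>simp_all del: times_divide_eq_left\<close>)
    with i show "\<exists>i\<in>{..<n}. (\<Sum>j<m. 2 * ?c i j (?Z i j)) < (\<Sum>j<m. ?c i j (X i j) + ?c i j (Y i j))"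
      by blast
  qed simp
  also have "\<dots> = reg_cost n m lam M X + reg_cost n m lam M Y"
    unfolding reg_cost_def sum.distrib ..
  finally show False using min(1)[OF Z] min(2) by simp
qed

subsection \<open>Stability of the optimal plan\<close>

text \<open>Since \<open>ln (Y i j)\<close> is \<open>- lam * M i j\<close> plus potentials of
  \<open>i\<close> and of \<open>j\<close> alone, the potentials integrate against the marginals of
  \<open>X\<close>. Hence \<open>X\<close> enters only through its cost once \<open>a\<close> and
  \<open>b\<close> are fixed; \<open>Y\<close> may have other marginals.\<close>

lemma sum_rel_ent_gibbs:
  assumes lam: "lam \<noteq> 0" and X: "coupling n m a b X"
    and Y: "\<And>i j. i < n \<Longrightarrow> j < m \<Longrightarrow> Y i j = exp (- lam * (M i j - A i - B j))"
  shows "(\<Sum>i<n. \<Sum>j<m. rel_ent (X i j) (Y i j)) =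
    lam * reg_cost n m lam M X - lam * ((\<Sum>i<n. A i * a i) + (\<Sum>j<m. B j * b j)) +
    (\<Sum>i<n. \<Sum>j<m. Y i j)"
proof -
  have "(\<Sum>i<n. \<Sum>j<m. rel_ent (X i j) (Y i j)) =
    (\<Sum>i<n. \<Sum>j<m. lam * (X i j * M i j + 1 / lam * (X i j * (ln (X i j) - 1)))
       - (lam * (A i * X i j) + lam * (B j * X i j)) + Y i j)"
    using lam by (intro sum.cong refl) (simp add: rel_ent_def Y, simp add: algebra_simps diff_divide_distrib)
  also have "\<dots> = lam * reg_cost n m lam M X
      - (lam * (\<Sum>i<n. \<Sum>j<m. A i * X i j) + lam * (\<Sum>i<n. \<Sum>j<m. B j * X i j))
      + (\<Sum>i<n. \<Sum>j<m. Y i j)"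
    unfolding sum_subtractf sum.distrib[of "\<lambda>j. lam * (A _ * X _ j)"]
      sum.distrib[of "\<lambda>i. \<Sum>j<m. lam * (A i * X i j)"]
      sum.distrib[of "\<lambda>j. _ j - _ j"] sum.distrib[of "\<lambda>i. (\<Sum>j<m. _ i j) - _ i"]
      reg_cost_def by (simp add: sum_distrib_left)
  also have "(\<Sum>i<n. \<Sum>j<m. A i * X i j) = (\<Sum>i<n. A i * a i)"
    using X by (simp add: coupling_def flip: sum_distrib_left)
  also have "(\<Sum>i<n. \<Sum>j<m. B j * X i j) = (\<Sum>j<m. B j * b j)"
    using X by (subst sum.swap) (simp add: coupling_def flip: sum_distrib_left)
  finally show ?thesis by (simp add: algebra_simps)
qed

text \<open>Lower cost means lower relative entropy to \<open>Y\<close>. The lower bound on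
  \<open>rel_ent\<close> then controls one entry of \<open>X\<close>, and the chi-square bound
  estimates the total for the competitor \<open>Z\<close>.\<close>

lemma minimizer_near_gibbs:
  assumes lam: "lam > 0" and X: "coupling n m a b X" and Z: "coupling n m a b Z"
    and le: "reg_cost n m lam M X \<le> reg_cost n m lam M Z"
    and Y: "\<And>i j. i < n \<Longrightarrow> j < m \<Longrightarrow> Y i j = exp (- lam * (M i j - A i - B j))"
    and Y2: "\<And>i j. i < n \<Longrightarrow> j < m \<Longrightarrow> Y i j \<le> 2"
    and Zpos: "\<And>i j. i < n \<Longrightarrow> j < m \<Longrightarrow> 0 < Z i j"
    and X1: "\<And>i j. i < n \<Longrightarrow> j < m \<Longrightarrow> X i j \<le> 1"
    and i: "i < n" and j: "j < m"
  shows "(X i j - Y i j)\<^sup>2 \<le> 6 * (\<Sum>i<n. \<Sum>j<m. (Z i j - Y i j)\<^sup>2 / Y i j)"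
proof -
  have Ypos: "0 < Y i j" if "i < n" "j < m" for i j
    using Y[OF that] by simp
  have X0: "0 \<le> X i j" if "i < n" "j < m" for i j
    using X that by (simp add: coupling_def)
  have "(X i j - Y i j)\<^sup>2 \<le> 6 * rel_ent (X i j) (Y i j)"
    using X0 X1 Ypos Y2 i j by (intro square_diff_le_rel_ent) auto
  also have "rel_ent (X i j) (Y i j) \<le> (\<Sum>j<m. rel_ent (X i j) (Y i j))"
    using X0 Ypos i j by (intro member_le_sum rel_ent_nonneg) auto
  also have "\<dots> \<le> (\<Sum>i<n. \<Sum>j<m. rel_ent (X i j) (Y i j))"
    using X0 Ypos i j by (intro member_le_sum sum_nonneg rel_ent_nonneg) auto
  also have "\<dots> \<le> (\<Sum>i<n. \<Sum>j<m. rel_ent (Z i j) (Y i j))"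
    using lam le sum_rel_ent_gibbs[OF _ X Y] sum_rel_ent_gibbs[OF _ Z Y] by simp
  also have "\<dots> \<le> (\<Sum>i<n. \<Sum>j<m. (Z i j - Y i j)\<^sup>2 / Y i j)"
    using Zpos Ypos by (intro sum_mono rel_ent_upper) auto
  finally show ?thesis by simp
qed

text \<open>Here \<open>q\<close> is \<open>o(t^2)\<close>, so \<open>g - f\<close>, bounded by its
  square root, is \<open>o(t)\<close> and leaves the derivative unchanged.\<close>

lemma DERIV_of_close:
  fixes f g q :: "real \<Rightarrow> real"
  assumes f: "(f has_real_derivative D) (at 0)"
    and close: "\<forall>\<^sub>F t in nhds 0. (g t - f t)\<^sup>2 \<le> q t"
    and q: "((\<lambda>t. q t / t\<^sup>2) \<longlongrightarrow> 0) (at 0)" "q 0 = 0"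
  shows "(g has_real_derivative D) (at 0)"
proof -
  \<comment> \<open>The filter \<open>nhds 0\<close> includes the point 0 itself, where
    \<open>q\<close> vanishes.\<close>
  have 0: "g 0 = f 0"
    using eventually_nhds_x_imp_x[OF close] q(2) by simp
  have "((\<lambda>t. sqrt (q t / t\<^sup>2)) \<longlongrightarrow> sqrt 0) (at 0)"
    by (intro tendsto_real_sqrt q)
  hence s: "((\<lambda>t. sqrt (q t / t\<^sup>2)) \<longlongrightarrow> 0) (at 0)" by simp
  have "\<forall>\<^sub>F t in at 0. (g t - f t)\<^sup>2 \<le> q t"
    using close unfolding eventually_at_filter by (rule eventually_mono) simp
  hence "\<forall>\<^sub>F t in at 0. norm ((g t - f t) / t) \<le> sqrt (q t / t\<^sup>2)"
  proof (rule eventually_mono)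
    fix t assume "(g t - f t)\<^sup>2 \<le> q t"
    hence "(g t - f t)\<^sup>2 / t\<^sup>2 \<le> q t / t\<^sup>2"
      by (intro divide_right_mono) auto
    thus "norm ((g t - f t) / t) \<le> sqrt (q t / t\<^sup>2)"
      by (intro real_le_rsqrt) (simp add: power_divide)
  qed
  from Lim_null_comparison[OF this s]
  have "((\<lambda>t. (g t - f t) / t) \<longlongrightarrow> 0) (at 0)" .
  moreover have "((\<lambda>t. (f t - f 0) / t) \<longlongrightarrow> D) (at 0)"
    using f by (simp add: DERIV_def)
  ultimately have "((\<lambda>t. (f t - f 0) / t + (g t - f t) / t) \<longlongrightarrow> D + 0) (at 0)"
    by (intro tendsto_add)
  thus ?thesis
    by (simp add: DERIV_def 0 flip: add_divide_distrib)
qed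

lemma DERIV_zero_quotient:
  fixes f :: "real \<Rightarrow> real"
  assumes "(f has_real_derivative 0) (at 0)" "f 0 = 0"
  shows "((\<lambda>t. f t / t) \<longlongrightarrow> 0) (at 0)"
  using assms by (simp add: DERIV_def)

text \<open>\<open>row\<close> and \<open>col\<close> are the linearized marginal constraints: the
  velocity \<open>dT\<close> of the Gibbs kernel changes the row sums at rate \<open>v\<close> and
  keeps the column sums.\<close>

lemma minimizer_DERIV:
  fixes a b \<alpha> \<beta> d\<alpha> d\<beta> v :: "nat \<Rightarrow> real" and M :: "nat \<Rightarrow> nat \<Rightarrow> real"
  assumes lam: "lam > 0" and nm: "n > 0" "m > 0"
  defines "T \<equiv> \<lambda>i j. exp (- lam * (M i j - \<alpha> i - \<beta> j))"
  defines "dT \<equiv> \<lambda>i j. lam * T i j * (d\<alpha> i + d\<beta> j)"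
  assumes T: "coupling n m a b T" and mass: "(\<Sum>i<n. a i) = 1"
    and row: "\<And>i. i < n \<Longrightarrow> (\<Sum>j<m. dT i j) = v i"
    and col: "\<And>j. j < m \<Longrightarrow> (\<Sum>i<n. dT i j) = 0"
    and P: "\<forall>\<^sub>F t in nhds 0. coupling n m (\<lambda>i. a i + t * v i) b (P t) \<and>
      (\<forall>Z. coupling n m (\<lambda>i. a i + t * v i) b Z \<longrightarrow>
         reg_cost n m lam M (P t) \<le> reg_cost n m lam M Z)"
    and i: "i < n" and j: "j < m"
  shows "((\<lambda>t. P t i j) has_real_derivative dT i j) (at 0)"
proof -
  define Y where "Y t i j = T i j * exp (lam * t * (d\<alpha> i + d\<beta> j))" for t i j
  define ra where "ra t i = a i + t * v i - (\<Sum>j<m. Y t i j)" for t i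
  define rb where "rb t j = b j - (\<Sum>i<n. Y t i j)" for t j
  define c where "c t = (\<Sum>i<n. ra t i)" for t
  \<comment> \<open>\<open>R t\<close> has row sums \<open>ra t\<close> and column sums \<open>rb t\<close>, since both have total \<open>c t\<close>.\<close>
  define R where "R t i j = ra t i / m + rb t j / n - c t / (m * n)" for t i j
  \<comment> \<open>The bound of \<open>minimizer_near_gibbs\<close> for the competitor
    \<open>Y t + R t\<close>; it is \<open>o(t^2)\<close> because \<open>R t\<close> is
    \<open>o(t)\<close>.\<close>
  define q where "q t = 6 * (\<Sum>i<n. \<Sum>j<m. (R t i j)\<^sup>2 / Y t i j)" for t
  have Y0: "Y 0 i j = T i j" for i j
    by (simp add: Y_def)
  have Ypos: "0 < Y t i j" for t i j
    by (simp add: Y_def T_def)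
  have Yeq: "Y t i j = exp (- lam * (M i j - (\<alpha> i + t * d\<alpha> i) - (\<beta> j + t * d\<beta> j)))" for t i j
    by (simp add: Y_def T_def algebra_simps flip: exp_add)
  have dY: "((\<lambda>t. Y t i j) has_real_derivative dT i j) (at 0)" for i j
    unfolding Y_def dT_def by (rule derivative_eq_intros refl | simp)+
  have dra: "((\<lambda>t. ra t i) has_real_derivative 0) (at 0)" if "i < n" for i
    unfolding ra_def
    by (rule derivative_eq_intros dY refl | simp add: row[OF that])+
  have drb: "((\<lambda>t. rb t j) has_real_derivative 0) (at 0)" if "j < m" for j
    unfolding rb_def
    by (rule derivative_eq_intros dY refl | simp add: col[OF that])+
  have dc: "(c has_real_derivative 0) (at 0)"
    unfolding c_def[abs_def] by (rule DERIV_cong[OF DERIV_sum[OF dra]]) auto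
  have dR: "((\<lambda>t. R t i j) has_real_derivative 0) (at 0)" if "i < n" "j < m" for i j
    unfolding R_def using nm
    by (auto intro!: derivative_eq_intros dra drb dc that)
  have ra0: "ra 0 i = 0" if "i < n" for i
    using T that by (simp add: ra_def Y0 coupling_def)
  have rb0: "rb 0 j = 0" if "j < m" for j
    using T that by (simp add: rb_def Y0 coupling_def)
  have R0: "R 0 i j = 0" if "i < n" "j < m" for i j
    using that by (simp add: R_def ra0 rb0 c_def)
  have b1: "(\<Sum>j<m. b j) = 1"
  proof -
    have "(\<Sum>j<m. b j) = (\<Sum>j<m. \<Sum>i<n. T i j)"
      using T by (simp add: coupling_def)
    also have "\<dots> = (\<Sum>i<n. \<Sum>j<m. T i j)" by (rule sum.swap)
    also have "\<dots> = 1" using T mass by (simp add: coupling_def)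
    finally show ?thesis .
  qed
  have v0: "(\<Sum>i<n. v i) = 0"
  proof -
    have "(\<Sum>i<n. v i) = (\<Sum>i<n. \<Sum>j<m. dT i j)" by (simp add: row)
    also have "\<dots> = (\<Sum>j<m. \<Sum>i<n. dT i j)" by (rule sum.swap)
    also have "\<dots> = 0" by (simp add: col)
    finally show ?thesis .
  qed
  \<comment> \<open>Both defects have the same total because \<open>a\<close> and \<open>b\<close>
    have mass 1 and \<open>v\<close> has mass 0; this makes the rank-one style correction
    \<open>R\<close> consistent.\<close>
  have rbc: "(\<Sum>j<m. rb t j) = c t" for t
    unfolding rb_def c_def ra_def
    by (simp add: sum_subtractf sum.distrib b1 mass v0 sum.swap[of _ "{..<m}"] flip: sum_distrib_left)
  have coupl: "coupling n m (\<lambda>i. a i + t * v i) b (\<lambda>i j. Y t i j + R t i j)"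
    if "\<And>i j. i < n \<Longrightarrow> j < m \<Longrightarrow> 0 < Y t i j + R t i j" for t
    unfolding coupling_def
  proof (intro conjI allI impI)
    fix i assume "i < n"
    have "(\<Sum>j<m. R t i j) = ra t i"
      using nm by (simp add: R_def sum_subtractf sum.distrib rbc flip: sum_divide_distrib)
    thus "(\<Sum>j<m. Y t i j + R t i j) = a i + t * v i"
      by (simp add: sum.distrib ra_def)
  next
    fix j assume "j < m"
    have "(\<Sum>i<n. R t i j) = rb t j"
      using nm by (simp add: R_def sum_subtractf sum.distrib flip: sum_divide_distrib c_def)
    thus "(\<Sum>i<n. Y t i j + R t i j) = b j"
      by (simp add: sum.distrib rb_def)
  qed (use that in \<open>auto intro: less_imp_le\<close>)
  have b_le: "b j \<le> 1" if "j < m" for j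
  proof -
    have "b j \<le> (\<Sum>j<m. b j)"
    proof (rule member_le_sum)
      fix k assume "k \<in> {..<m} - {j}"
      hence "b k = (\<Sum>i<n. T i k)" using T by (simp add: coupling_def)
      thus "0 \<le> b k" by (simp add: T_def sum_nonneg)
    qed (use that in auto)
    thus ?thesis by (simp add: b1)
  qed
  \<comment> \<open>Entries are at most 1; the strict bound 2 leaves slack, so it persists for
    \<open>Y t\<close> with small \<open>t\<close>.\<close>
  have T1: "T i j < 2" if "i < n" "j < m" for i j
    using coupling_le_col_marginal[OF T that] b_le[of j] that by simp
  have contY: "((\<lambda>t. Y t i j) \<longlongrightarrow> T i j) (nhds 0)" for i j
    using DERIV_isCont[OF dY[of i j]] Y0 tendsto_at_iff_tendsto_nhds[of "\<lambda>t. Y t i j" 0]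
    by (simp add: isCont_def)
  have contZ: "((\<lambda>t. Y t i j + R t i j) \<longlongrightarrow> T i j) (nhds 0)" if "i < n" "j < m" for i j
    using DERIV_isCont[OF DERIV_add[OF dY[of i j] dR[OF that]]] Y0 R0[OF that]
      tendsto_at_iff_tendsto_nhds[of "\<lambda>t. Y t i j + R t i j" 0]
    by (simp add: isCont_def)
  have evY: "\<forall>\<^sub>F t in nhds 0. \<forall>i\<in>{..<n}. \<forall>j\<in>{..<m}. Y t i j < 2"
    by (intro eventually_ball_finite ballI order_tendstoD(2)[OF contY] T1) auto
  have evZ: "\<forall>\<^sub>F t in nhds 0. \<forall>i\<in>{..<n}. \<forall>j\<in>{..<m}. 0 < Y t i j + R t i j"
    by (intro eventually_ball_finite ballI order_tendstoD(1)[OF contZ]) (auto simp: T_def)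
  have close: "\<forall>\<^sub>F t in nhds 0. (P t i j - Y t i j)\<^sup>2 \<le> q t"
    using P evY evZ
  proof eventually_elim
    case (elim t)
    let ?Z = "\<lambda>i j. Y t i j + R t i j"
    have Z: "coupling n m (\<lambda>i. a i + t * v i) b ?Z"
      using elim by (intro coupl) auto
    \<comment> \<open>The column marginal is used because \<open>b\<close> stays fixed, whereas the
      row marginal moves with \<open>t\<close>.\<close>
    have "P t i j \<le> 1" if "i < n" "j < m" for i j
      using coupling_le_col_marginal[of n m _ b "P t" i j] elim that b_le[of j] by fastforce
    hence "(P t i j - Y t i j)\<^sup>2 \<le> 6 * (\<Sum>i<n. \<Sum>j<m. (?Z i j - Y t i j)\<^sup>2 / Y t i j)"
      using elim Z i j
      by (intro minimizer_near_gibbs[OF lam _ Z _ Yeq]) (auto intro: less_imp_le)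
    thus ?case by (simp add: q_def)
  qed
  have "((\<lambda>t. 6 * (\<Sum>i<n. \<Sum>j<m. (R t i j / t)\<^sup>2 / Y t i j)) \<longlongrightarrow>
      6 * (\<Sum>i<n. \<Sum>j<m. 0\<^sup>2 / T i j)) (at 0)"
    by (intro tendsto_intros DERIV_zero_quotient dR R0 tendsto_mono[OF _ contY])
       (auto simp: T_def at_within_def)
  moreover have "6 * (\<Sum>i<n. \<Sum>j<m. (R t i j / t)\<^sup>2 / Y t i j) = q t / t\<^sup>2" for t
    by (simp add: q_def power_divide sum_distrib_left sum_divide_distrib mult.commute)
  ultimately have "((\<lambda>t. q t / t\<^sup>2) \<longlongrightarrow> 0) (at 0)" by simp
  moreover have "q 0 = 0" by (simp add: q_def R0)
  ultimately show ?thesis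
    using DERIV_of_close[OF dY close] by simp
qed

subsection \<open>The Sinkhorn plan\<close>

lemma transport_polytope_iff:
  assumes "a \<in> carrier_vec n" "b \<in> carrier_vec m"
  shows "T \<in> transport_polytope a b \<longleftrightarrow>
    T \<in> carrier_mat n m \<and> coupling n m (vec_index a) (vec_index b) (\<lambda>i j. T $$ (i, j))"
proof (cases "T \<in> carrier_mat n m")
  case True
  have "T *\<^sub>v ones_vec m = a \<longleftrightarrow> (\<forall>i<n. (\<Sum>j<m. T $$ (i, j)) = vec_index a i)"
    using True assms
    by (auto simp: vec_eq_iff ones_vec_def scalar_prod_def lessThan_atLeast0)
  moreover have "T\<^sup>T *\<^sub>v ones_vec n = b \<longleftrightarrow> (\<forall>j<m. (\<Sum>i<n. T $$ (i, j)) = vec_index b j)"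
    using True assms
    by (auto simp: vec_eq_iff ones_vec_def scalar_prod_def lessThan_atLeast0)
  ultimately show ?thesis
    using True assms by (auto simp: transport_polytope_def coupling_def)
qed (use assms in \<open>auto simp: transport_polytope_def\<close>)

lemma mat_inner_eq_sum:
  assumes "T \<in> carrier_mat n m" "M \<in> carrier_mat n m"
  shows "mat_inner T M = (\<Sum>i<n. \<Sum>j<m. T $$ (i, j) * M $$ (i, j))"
proof -
  have "mat_inner T M = (\<Sum>j<m. \<Sum>i<n. T $$ (i, j) * M $$ (i, j))"
    using assms by (simp add: mat_inner_def mat_trace_def scalar_prod_def lessThan_atLeast0)
  thus ?thesis by (simp add: sum.swap[of _ "{..<m}"])
qed

lemma regularized_objective_eq:
  assumes "T \<in> carrier_mat n m" "M \<in> carrier_mat n m"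
  shows "mat_inner T M - 1 / lam * entropy T =
    reg_cost n m lam (\<lambda>i j. M $$ (i, j)) (\<lambda>i j. T $$ (i, j))"
  using assms
  by (simp add: mat_inner_eq_sum entropy_def reg_cost_def sum.distrib sum_divide_distrib)

lemma coupling_product:
  assumes "a \<in> prob_simplex n" "b \<in> prob_simplex m"
  shows "coupling n m (vec_index a) (vec_index b) (\<lambda>i j. vec_index a i * vec_index b j)"
  using assms by (simp add: coupling_def prob_simplex_def flip: sum_distrib_left sum_distrib_right)

text \<open>Resolves the definite description: the product coupling makes the feasible set nonempty,
  compactness gives existence and strict convexity gives uniqueness.\<close>

lemma sinkhorn_plan_minimizer:
  assumes lam: "lam > 0" and M: "M \<in> carrier_mat n m"
    and a: "a \<in> prob_simplex n" and b: "b \<in> prob_simplex m"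
  defines "P \<equiv> sinkhorn_plan lam M a b"
  shows "P \<in> carrier_mat n m"
    and "coupling n m (vec_index a) (vec_index b) (\<lambda>i j. P $$ (i, j))"
    and "coupling n m (vec_index a) (vec_index b) Z \<Longrightarrow>
      reg_cost n m lam (\<lambda>i j. M $$ (i, j)) (\<lambda>i j. P $$ (i, j)) \<le>
      reg_cost n m lam (\<lambda>i j. M $$ (i, j)) Z"
proof -
  let ?C = "coupling n m (vec_index a) (vec_index b)"
  let ?E = "reg_cost n m lam (\<lambda>i j. M $$ (i, j))"
  let ?min = "is_arg_min (\<lambda>T. mat_inner T M - 1 / lam * entropy T) (\<lambda>T. T \<in> transport_polytope a b)"
  have ab: "a \<in> carrier_vec n" "b \<in> carrier_vec m"
    using a b by (auto simp: prob_simplex_def)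
  have min_iff: "?min T \<longleftrightarrow> T \<in> carrier_mat n m \<and> ?C (\<lambda>i j. T $$ (i, j)) \<and>
      (\<forall>Z. ?C Z \<longrightarrow> ?E (\<lambda>i j. T $$ (i, j)) \<le> ?E Z)" for T
  proof -
    \<comment> \<open>A competitor given as a function is cut down to an \<open>n\<close> by
      \<open>m\<close> matrix; cost and constraints see only these entries.\<close>
    have restrict: "?C (\<lambda>i j. Matrix.mat n m (\<lambda>(i, j). Z i j) $$ (i, j)) = ?C Z"
      "?E (\<lambda>i j. Matrix.mat n m (\<lambda>(i, j). Z i j) $$ (i, j)) = ?E Z" for Z
      by (simp_all add: coupling_def reg_cost_def)
    have "?E (\<lambda>i j. T $$ (i, j)) \<le> ?E Z" if "?min T" "?C Z" for Z
    proof -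
      let ?Z = "Matrix.mat n m (\<lambda>(i, j). Z i j)"
      have "?Z \<in> transport_polytope a b"
        using that(2) restrict[of Z] by (simp add: transport_polytope_iff[OF ab])
      hence "mat_inner T M - 1 / lam * entropy T \<le> mat_inner ?Z M - 1 / lam * entropy ?Z"
        using that(1) by (simp add: is_arg_min_linorder)
      moreover have "T \<in> carrier_mat n m"
        using that(1) by (auto simp: is_arg_min_linorder transport_polytope_iff[OF ab])
      ultimately show ?thesis
        using restrict(2)[of Z] regularized_objective_eq[OF _ M, of ?Z lam]
          regularized_objective_eq[OF _ M, of T lam] by simp
    qed
    moreover have "?min T" if "T \<in> carrier_mat n m" "?C (\<lambda>i j. T $$ (i, j))"
      "\<And>Z. ?C Z \<Longrightarrow> ?E (\<lambda>i j. T $$ (i, j)) \<le> ?E Z"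
      using that regularized_objective_eq[OF _ M]
      by (auto simp: is_arg_min_linorder transport_polytope_iff[OF ab])
    moreover have "T \<in> carrier_mat n m \<and> ?C (\<lambda>i j. T $$ (i, j))" if "?min T"
      using that by (auto simp: is_arg_min_linorder transport_polytope_iff[OF ab])
    ultimately show ?thesis by blast
  qed
  obtain Y where Y: "?C Y" "\<And>Z. ?C Z \<Longrightarrow> ?E Y \<le> ?E Z"
    by (rule reg_cost_minimizer_exists[OF coupling_product[OF a b]]) blast
  let ?Y = "Matrix.mat n m (\<lambda>(i, j). Y i j)"
  have "?min ?Y"
    unfolding min_iff using Y by (auto simp: coupling_def reg_cost_def)
  moreover have "T = ?Y" if "?min T" for T
  proof (rule eq_matI)
    fix i j assume "i < dim_row ?Y" "j < dim_col ?Y"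
    hence ij: "i < n" "j < m" by auto
    have T: "?C (\<lambda>i j. T $$ (i, j))" "?E (\<lambda>i j. T $$ (i, j)) \<le> ?E Y"
      using that Y(1) unfolding min_iff by auto
    show "T $$ (i, j) = ?Y $$ (i, j)"
      using reg_cost_minimizer_unique[OF lam Y(1) T(1) Y(2) T(2) ij] ij by simp
  qed (use that[unfolded min_iff] in auto)
  ultimately have "?min P"
    unfolding P_def sinkhorn_plan_def by (rule theI)
  thus "P \<in> carrier_mat n m" "?C (\<lambda>i j. P $$ (i, j))"
    "?C Z \<Longrightarrow> ?E (\<lambda>i j. P $$ (i, j)) \<le> ?E Z"
    unfolding min_iff by auto
qed

text \<open>The projection subtracts the mean \<open>c\<close> from every coordinate. The second
  claim is why projecting a gradient preserves its derivatives in tangent directions.\<close>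

lemma orth_proj_tangent_simplex:
  assumes x: "x \<in> carrier_vec n" and n: "n > 0"
  shows "orth_proj (tangent_simplex n) x \<in> tangent_simplex n"
    and "v \<in> tangent_simplex n \<Longrightarrow> orth_proj (tangent_simplex n) x \<bullet> v = x \<bullet> v"
proof -
  let ?W = "tangent_simplex n"
  let ?P = "\<lambda>y. y \<in> ?W \<and> (\<forall>w\<in>?W. (x - y) \<bullet> w = 0)"
  define c where "c = (\<Sum>i<n. vec_index x i) / n"
  define y where "y = Matrix.vec n (\<lambda>i. vec_index x i - c)"
  have dot: "u \<bullet> w = (\<Sum>i<n. vec_index u i * vec_index w i)" if "w \<in> carrier_vec n"
    for u w :: "real Matrix.vec"
    using that by (simp add: scalar_prod_def lessThan_atLeast0)
  have W: "w \<in> carrier_vec n" if "w \<in> ?W" for w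
    using that by (simp add: tangent_simplex_def)
  have yP: "?P y"
  proof (intro conjI ballI)
    show "y \<in> ?W"
      using n by (simp add: y_def tangent_simplex_def sum_subtractf c_def)
    fix w assume w: "w \<in> ?W"
    have "(x - y) \<bullet> w = (\<Sum>i<n. c * vec_index w i)"
      using x by (simp add: dot[OF W[OF w]] y_def)
    also have "\<dots> = 0"
      using w by (simp add: tangent_simplex_def flip: sum_distrib_left)
    finally show "(x - y) \<bullet> w = 0" .
  qed
  moreover have "y' = y" if y': "?P y'" for y'
  proof -
    have d: "y' - y \<in> ?W"
      using y' yP by (auto simp: tangent_simplex_def sum_subtractf)
    have "(x - y) \<bullet> (y' - y) = 0" "(x - y') \<bullet> (y' - y) = 0"
      using y' yP d by auto
    hence "(x - y) \<bullet> (y' - y) - (x - y') \<bullet> (y' - y) = 0" by simp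
    hence "(\<Sum>i<n. (vec_index y' i - vec_index y i)\<^sup>2) = 0"
      using x y' yP W[of y] W[of y']
      by (simp add: dot[OF W[OF d]] power2_eq_square left_diff_distrib flip: sum_subtractf)
    hence "\<forall>i<n. vec_index y' i = vec_index y i"
      by (subst (asm) sum_nonneg_eq_0_iff) auto
    thus ?thesis using W[of y] W[of y'] y' yP by auto
  qed
  ultimately have P: "?P (orth_proj ?W x)"
    unfolding orth_proj_def by (rule theI)
  thus "orth_proj ?W x \<in> ?W" by simp
  show "orth_proj ?W x \<bullet> v = x \<bullet> v" if v: "v \<in> ?W"
    using P v x W[of "orth_proj ?W x"]
    by (auto simp: minus_scalar_prod_distrib[of _ n] W[OF v])
qed

subsection \<open>The dual Hessian and the gradient\<close>

locale sinkhorn_data =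
  fixes n m :: nat and M :: "real mat" and a b :: "real Matrix.vec" and lam :: real
  assumes M: "M \<in> carrier_mat n m" and a: "a \<in> prob_simplex n" and b: "b \<in> prob_simplex m"
    and lam: "lam > 0"
begin

definition N :: nat where "N = n + (m - 1)"

text \<open>\<open>col_pot\<close> restores the gauge \<open>\<beta>\<^sub>m = 0\<close> in a vector of free dual variables.\<close>

definition col_pot :: "real Matrix.vec \<Rightarrow> nat \<Rightarrow> real" where
  "col_pot z j = (if j < m - 1 then vec_index z (n + j) else 0)"

text \<open>The pairing of \<open>z\<close> with the vector written \<open>e_ij\<close> in the
  overview.\<close>

definition pot :: "real Matrix.vec \<Rightarrow> nat \<Rightarrow> nat \<Rightarrow> real" where
  "pot z i j = vec_index z i + col_pot z j"

definition gibbs :: "real Matrix.vec \<Rightarrow> nat \<Rightarrow> nat \<Rightarrow> real" where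
  "gibbs z i j = exp (- lam * (M $$ (i, j) - vec_index z i - col_pot z j))"

text \<open>The linear part of the dual function.\<close>

definition margin :: "real Matrix.vec \<Rightarrow> real" where
  "margin w = (\<Sum>i<n. vec_index w i * vec_index a i) + (\<Sum>j<m. col_pot w j * vec_index b j)"

lemma carrier: "a \<in> carrier_vec n" "b \<in> carrier_vec m"
  using a b by (auto simp: prob_simplex_def)

lemma dims [simp]: "dim_vec a = n" "dim_vec b = m" "dim_row M = n" "dim_col M = m"
  using carrier M by auto

lemma n_pos: "n > 0" and m_pos: "m > 0"
  using a b by (auto simp: prob_simplex_def intro!: Nat.gr0I)

lemma sum_cols: "(\<Sum>j<m. f j) = (\<Sum>j<m - 1. f j) + (f (m - 1) :: real)"
  using m_pos by (cases m) auto

lemma less_N: "i < n \<Longrightarrow> i < N"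
  by (simp add: N_def)

lemma col_pot_add_smult:
  "z \<in> carrier_vec N \<Longrightarrow> w \<in> carrier_vec N \<Longrightarrow> col_pot (z + t \<cdot>\<^sub>v w) j = col_pot z j + t * col_pot w j"
  by (auto simp: col_pot_def N_def)

lemma pot_unit_row:
  assumes "k < n" "i < n"
  shows "pot (unit_vec N k) i j = of_bool (i = k)"
  using assms by (auto simp: pot_def col_pot_def N_def unit_vec_def)

lemma pot_unit_col:
  assumes "k < m - 1" "i < n"
  shows "pot (unit_vec N (n + k)) i j = of_bool (j = k)"
  using assms by (auto simp: pot_def col_pot_def N_def unit_vec_def)

text \<open>Pairing with unit vectors reads off the coordinates of the sum of all
  \<open>f i j * e_ij\<close>: row sums first and then, in the next lemma, the first
  \<open>m - 1\<close> column sums.\<close>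

lemma sum_pot_unit_row:
  assumes "k < n"
  shows "(\<Sum>i<n. \<Sum>j<m. pot (unit_vec N k) i j * f i j) = (\<Sum>j<m. f k j)"
proof -
  have "(\<Sum>i<n. \<Sum>j<m. pot (unit_vec N k) i j * f i j) =
      (\<Sum>i<n. if i = k then (\<Sum>j<m. f i j) else 0)"
    by (rule sum.cong) (auto simp: pot_unit_row[OF assms])
  thus ?thesis using assms by (simp add: sum.delta)
qed

lemma sum_pot_unit_col:
  assumes "k < m - 1"
  shows "(\<Sum>i<n. \<Sum>j<m. pot (unit_vec N (n + k)) i j * f i j) = (\<Sum>i<n. f i k)"
proof (rule sum.cong)
  fix i assume "i \<in> {..<n}"
  hence "(\<Sum>j<m. pot (unit_vec N (n + k)) i j * f i j) = (\<Sum>j<m. if j = k then f i j else 0)"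
    by (intro sum.cong) (auto simp: pot_unit_col[OF assms])
  thus "(\<Sum>j<m. pot (unit_vec N (n + k)) i j * f i j) = f i k"
    using assms by (simp add: sum.delta)
qed simp

lemma sum_N: "(\<Sum>k<N. f k) = (\<Sum>i<n. f i) + (\<Sum>j<m - 1. f (n + j) :: real)"
proof -
  have "(\<Sum>k<n + p. f k) = (\<Sum>i<n. f i) + (\<Sum>j<p. f (n + j))" for p
    by (induction p) simp_all
  thus ?thesis by (simp only: N_def)
qed

lemma sum_pot_unit_coordinates:
  assumes "i < n" "j < m"
  shows "(\<Sum>k<N. pot (unit_vec N k) i j * vec_index w k) = pot w i j"
  using assms by (simp add: sum_N pot_unit_row pot_unit_col)
    (simp add: pot_def col_pot_def of_bool_def if_distrib[of "\<lambda>x. x * _"] sum.delta cong: if_cong)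

lemma dual_fun_free_eq:
  assumes z: "z \<in> carrier_vec N"
  shows "dual_fun_free lam M a b z = margin z - 1 / lam * (\<Sum>i<n. \<Sum>j<m. gibbs z i j)"
proof -
  define \<beta> where "\<beta> = vec_last z (m - 1) @\<^sub>v 0\<^sub>v 1"
  have "vec_index \<beta> j = col_pot z j" if "j < m" for j
    using z that by (auto simp: \<beta>_def col_pot_def vec_last_def N_def)
  moreover have "vec_index (vec_first z n) i = vec_index z i" if "i < n" for i
    using that by (simp add: vec_first_def)
  ultimately show ?thesis
    unfolding dual_fun_free_def dual_fun_def margin_def gibbs_def scalar_prod_def dims
      \<beta>_def[symmetric]
    by (simp add: lessThan_atLeast0)
qed

section \<open>Derivatives of the dual function\<close>

lemma DERIV_gibbs:
  assumes "z \<in> carrier_vec N" "w \<in> carrier_vec N" "i < n"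
  shows "((\<lambda>t. gibbs (z + t \<cdot>\<^sub>v w) i j) has_real_derivative lam * (pot w i j * gibbs z i j)) (at 0)"
proof -
  have i: "i < N" using assms(3) by (simp add: N_def)
  have "(\<lambda>t. gibbs (z + t \<cdot>\<^sub>v w) i j) =
      (\<lambda>t. exp (- lam * (M $$ (i, j) - (vec_index z i + t * vec_index w i) - (col_pot z j + t * col_pot w j))))"
    using assms i by (simp add: gibbs_def col_pot_add_smult)
  thus ?thesis
    unfolding gibbs_def pot_def
    by (auto intro!: derivative_eq_intros simp: algebra_simps)
qed

lemma DERIV_dual_fun_free:
  assumes z: "z \<in> carrier_vec N" and w: "w \<in> carrier_vec N"
  shows "((\<lambda>t. dual_fun_free lam M a b (z + t \<cdot>\<^sub>v w)) has_real_derivative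
    margin w - (\<Sum>i<n. \<Sum>j<m. pot w i j * gibbs z i j)) (at 0)"
proof -
  have "margin (z + t \<cdot>\<^sub>v w) = margin z + t * margin w" for t
    using assms by (simp add: margin_def col_pot_add_smult less_N algebra_simps sum.distrib sum_distrib_left)
  hence "(\<lambda>t. dual_fun_free lam M a b (z + t \<cdot>\<^sub>v w)) =
     (\<lambda>t. margin z + t * margin w - 1 / lam * (\<Sum>i<n. \<Sum>j<m. gibbs (z + t \<cdot>\<^sub>v w) i j))"
    using assms by (subst dual_fun_free_eq) auto
  moreover have "((\<lambda>t. margin z + t * margin w - 1 / lam * (\<Sum>i<n. \<Sum>j<m. gibbs (z + t \<cdot>\<^sub>v w) i j))
     has_real_derivative (0 + margin w - 1 / lam * (\<Sum>i<n. \<Sum>j<m. lam * (pot w i j * gibbs z i j)))) (at 0)"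
    using assms
    by (intro DERIV_diff DERIV_add DERIV_const DERIV_cmult DERIV_sum DERIV_gibbs DERIV_cmult_right[OF DERIV_ident, simplified]) auto
  ultimately show ?thesis
    using lam by (simp flip: sum_distrib_left)
qed

lemma partial_deriv_dual_fun_free:
  assumes z: "z \<in> carrier_vec N"
  shows "partial_deriv k (dual_fun_free lam M a b) z =
    margin (unit_vec N k) - (\<Sum>i<n. \<Sum>j<m. pot (unit_vec N k) i j * gibbs z i j)"
  unfolding partial_deriv_def
  using DERIV_imp_deriv[OF DERIV_dual_fun_free[OF z, of "unit_vec N k"]] z by simp

text \<open>In a first partial derivative the \<open>margin\<close> term is constant, so only the
  Gibbs terms are differentiated again.\<close>

lemma hessian_dual_fun_free:
  assumes z: "z \<in> carrier_vec N"
  shows "hessian (dual_fun_free lam M a b) z = Matrix.mat N N (\<lambda>(l, k).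
    - lam * (\<Sum>i<n. \<Sum>j<m. pot (unit_vec N l) i j * (pot (unit_vec N k) i j * gibbs z i j)))"
proof -
  have "partial_deriv l (partial_deriv k (dual_fun_free lam M a b)) z =
    - lam * (\<Sum>i<n. \<Sum>j<m. pot (unit_vec N l) i j * (pot (unit_vec N k) i j * gibbs z i j))" for l k
  proof -
    have "(\<lambda>t. partial_deriv k (dual_fun_free lam M a b) (z + t \<cdot>\<^sub>v unit_vec N l)) =
      (\<lambda>t. margin (unit_vec N k) -
         (\<Sum>i<n. \<Sum>j<m. pot (unit_vec N k) i j * gibbs (z + t \<cdot>\<^sub>v unit_vec N l) i j))"
      using z by (subst partial_deriv_dual_fun_free) auto
    moreover have "((\<lambda>t. margin (unit_vec N k) -
         (\<Sum>i<n. \<Sum>j<m. pot (unit_vec N k) i j * gibbs (z + t \<cdot>\<^sub>v unit_vec N l) i j))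
       has_real_derivative (0 - (\<Sum>i<n. \<Sum>j<m. pot (unit_vec N k) i j *
          (lam * (pot (unit_vec N l) i j * gibbs z i j))))) (at 0)"
      using z by (intro DERIV_diff DERIV_const DERIV_sum DERIV_cmult DERIV_gibbs) auto
    ultimately show ?thesis
      unfolding partial_deriv_def[of l] using z
      by (simp add: DERIV_imp_deriv sum_distrib_left sum_negf mult.left_commute)
  qed
  thus ?thesis
    using z by (auto simp: hessian_def intro!: cong_mat)
qed

lemma hessian_carrier:
  "z \<in> carrier_vec N \<Longrightarrow> hessian (dual_fun_free lam M a b) z \<in> carrier_mat N N"
  by (simp add: hessian_def)

lemma hessian_mult_vec:
  assumes z: "z \<in> carrier_vec N" and w: "w \<in> carrier_vec N" and l: "l < N"
  shows "vec_index (hessian (dual_fun_free lam M a b) z *\<^sub>v w) l =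
    - lam * (\<Sum>i<n. \<Sum>j<m. pot (unit_vec N l) i j * (pot w i j * gibbs z i j))"
proof -
  have "vec_index (hessian (dual_fun_free lam M a b) z *\<^sub>v w) l =
    (\<Sum>k<N. - lam * (\<Sum>i<n. \<Sum>j<m. pot (unit_vec N l) i j * (pot (unit_vec N k) i j * gibbs z i j)) * vec_index w k)"
    using w l by (simp add: hessian_dual_fun_free[OF z] scalar_prod_def lessThan_atLeast0)
  also have "\<dots> = - lam * (\<Sum>k<N. \<Sum>i<n. \<Sum>j<m. pot (unit_vec N l) i j * (pot (unit_vec N k) i j * vec_index w k * gibbs z i j))"
    by (simp add: sum_distrib_left sum_distrib_right mult_ac)
  also have "(\<Sum>k<N. \<Sum>i<n. \<Sum>j<m. pot (unit_vec N l) i j * (pot (unit_vec N k) i j * vec_index w k * gibbs z i j)) =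
    (\<Sum>i<n. \<Sum>j<m. \<Sum>k<N. pot (unit_vec N l) i j * (pot (unit_vec N k) i j * vec_index w k * gibbs z i j))"
    by (subst sum.swap, rule sum.cong[OF refl], rule sum.swap)
  also have "\<dots> = (\<Sum>i<n. \<Sum>j<m. pot (unit_vec N l) i j * (pot w i j * gibbs z i j))"
    by (intro sum.cong refl)
      (simp add: sum_pot_unit_coordinates flip: sum_distrib_left sum_distrib_right)
  finally show ?thesis .
qed

text \<open>The right side is symmetric in \<open>u\<close> and \<open>w\<close>; it serves both
  definiteness and the exchange of the two vectors in the gradient formula.\<close>

lemma hessian_quadratic_form:
  assumes z: "z \<in> carrier_vec N" and w: "w \<in> carrier_vec N" and u: "u \<in> carrier_vec N"
  shows "(hessian (dual_fun_free lam M a b) z *\<^sub>v w) \<bullet> u =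
    - lam * (\<Sum>i<n. \<Sum>j<m. pot u i j * (pot w i j * gibbs z i j))"
proof -
  have "(hessian (dual_fun_free lam M a b) z *\<^sub>v w) \<bullet> u =
    (\<Sum>k<N. vec_index (hessian (dual_fun_free lam M a b) z *\<^sub>v w) k * vec_index u k)"
    using u by (simp add: scalar_prod_def lessThan_atLeast0)
  also have "\<dots> = (\<Sum>k<N. - lam * (\<Sum>i<n. \<Sum>j<m. pot (unit_vec N k) i j * (pot w i j * gibbs z i j)) * vec_index u k)"
    using z w by (intro sum.cong refl) (simp only: hessian_mult_vec lessThan_iff)
  also have "\<dots> = - lam * (\<Sum>k<N. \<Sum>i<n. \<Sum>j<m. pot (unit_vec N k) i j * vec_index u k * (pot w i j * gibbs z i j))"
    by (simp add: sum_distrib_left sum_distrib_right mult_ac)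
  also have "(\<Sum>k<N. \<Sum>i<n. \<Sum>j<m. pot (unit_vec N k) i j * vec_index u k * (pot w i j * gibbs z i j)) =
    (\<Sum>i<n. \<Sum>j<m. \<Sum>k<N. pot (unit_vec N k) i j * vec_index u k * (pot w i j * gibbs z i j))"
    by (subst sum.swap, rule sum.cong[OF refl], rule sum.swap)
  also have "\<dots> = (\<Sum>i<n. \<Sum>j<m. pot u i j * (pot w i j * gibbs z i j))"
    by (intro sum.cong refl) (simp add: sum_pot_unit_coordinates flip: sum_distrib_right)
  finally show ?thesis .
qed

text \<open>A kernel vector makes a sum of nonnegative terms vanish. As the Gibbs weights are
  positive, all \<open>pot w i j\<close> are zero, and the gauge then forces
  \<open>w = 0\<close>.\<close>

lemma hessian_invertible:
  assumes z: "z \<in> carrier_vec N"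
  obtains K where "mat_inverse (hessian (dual_fun_free lam M a b) z) = Some K"
    "hessian (dual_fun_free lam M a b) z * K = 1\<^sub>m N" "K \<in> carrier_mat N N"
proof -
  let ?H = "hessian (dual_fun_free lam M a b) z"
  have H: "?H \<in> carrier_mat N N" by (rule hessian_carrier[OF z])
  have "w = 0\<^sub>v N" if w: "w \<in> carrier_vec N" and 0: "?H *\<^sub>v w = 0\<^sub>v N" for w
  proof -
    have "(\<Sum>i<n. \<Sum>j<m. pot w i j * (pot w i j * gibbs z i j)) = 0"
      using hessian_quadratic_form[OF z w w] lam w 0 by simp
    moreover have nn: "0 \<le> pot w i j * (pot w i j * gibbs z i j)" for i j
      by (simp add: gibbs_def flip: mult.assoc)
    ultimately have "\<forall>i<n. \<forall>j<m. pot w i j * (pot w i j * gibbs z i j) = 0"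
      by (simp add: sum_nonneg_eq_0_iff sum_nonneg)
    hence pot: "pot w i j = 0" if "i < n" "j < m" for i j
      using that by (simp add: gibbs_def)
    \<comment> \<open>In the last column the gauge sets \<open>col_pot\<close> to 0, which isolates
      the row potentials; row 0 then isolates the column potentials.\<close>
    have row: "vec_index w i = 0" if "i < n" for i
      using pot[OF that, of "m - 1"] m_pos by (simp add: pot_def col_pot_def)
    have col: "vec_index w (n + j) = 0" if "j < m - 1" for j
      using pot[OF n_pos, of j] row[OF n_pos] that by (simp add: pot_def col_pot_def)
    show ?thesis
    proof (rule eq_vecI)
      fix k assume "k < dim_vec (0\<^sub>v N)"
      hence k: "k < N" by simp
      show "vec_index w k = vec_index (0\<^sub>v N) k"
        using row[of k] col[of "k - n"] k by (cases "k < n") (auto simp: N_def)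
    qed (use w in simp)
  qed
  hence "det ?H \<noteq> 0"
    unfolding det_0_iff_vec_prod_zero_field[OF H] by blast
  hence "?H \<in> Units (ring_mat TYPE(real) N ())"
    by (rule det_non_zero_imp_unit[OF H])
  then obtain K where K: "mat_inverse ?H = Some K"
    using mat_inverse(1)[OF H, where b = "()"] by (cases "mat_inverse ?H") auto
  show ?thesis
    using that K mat_inverse(2)[OF H K] by blast
qed

section \<open>Stationarity of the dual and the marginal constraints\<close>

lemma margin_unit_row: "k < n \<Longrightarrow> margin (unit_vec N k) = vec_index a k"
  by (simp add: margin_def col_pot_def N_def unit_vec_def if_distrib[of "\<lambda>x. x * _"] sum.delta
    cong: if_cong)

lemma margin_unit_col:
  assumes "k < m - 1"
  shows "margin (unit_vec N (n + k)) = vec_index b k"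
proof -
  have "(\<Sum>j<m. col_pot (unit_vec N (n + k)) j * vec_index b j) =
    (\<Sum>j<m. if j = k then vec_index b j else 0)"
    using assms by (intro sum.cong) (auto simp: col_pot_def N_def unit_vec_def)
  moreover have "(\<Sum>i<n. vec_index (unit_vec N (n + k)) i * vec_index a i) = 0"
    by (intro sum.neutral) (simp add: N_def unit_vec_def)
  moreover have "k < m" using assms by simp
  ultimately show ?thesis by (simp add: margin_def sum.delta)
qed

text \<open>The last column has no free dual variable; its marginal condition follows from equality of
  the total masses.\<close>

lemma last_col_sum:
  assumes "\<And>i. i < n \<Longrightarrow> (\<Sum>j<m. f i j) = (r i :: real)"
    and "\<And>j. j < m - 1 \<Longrightarrow> (\<Sum>i<n. f i j) = s j"
    and "(\<Sum>i<n. r i) = (\<Sum>j<m. s j)" and "j < m"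
  shows "(\<Sum>i<n. f i j) = s j"
proof (cases "j < m - 1")
  case False
  hence j: "j = m - 1" using assms(4) by simp
  have "(\<Sum>j<m. \<Sum>i<n. f i j) = (\<Sum>i<n. \<Sum>j<m. f i j)" by (rule sum.swap)
  also have "\<dots> = (\<Sum>j<m. s j)" by (simp add: assms)
  finally show ?thesis by (simp add: sum_cols assms(2) j)
qed (use assms in auto)

text \<open>Each stationarity equation is one marginal condition; equality of total masses supplies
  the last column.\<close>

lemma critical_point_coupling:
  assumes "\<And>k. k < N \<Longrightarrow>
    margin (unit_vec N k) = (\<Sum>i<n. \<Sum>j<m. pot (unit_vec N k) i j * gibbs z i j)"
  shows "coupling n m (vec_index a) (vec_index b) (gibbs z)"
proof -
  have row: "(\<Sum>j<m. gibbs z i j) = vec_index a i" if "i < n" for i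
    using assms[of i] that less_N[OF that] by (simp add: margin_unit_row sum_pot_unit_row)
  have col: "(\<Sum>i<n. gibbs z i j) = vec_index b j" if "j < m - 1" for j
  proof -
    have "n + j < N" using that by (simp add: N_def)
    from assms[OF this] show ?thesis
      by (simp add: margin_unit_col[OF that] sum_pot_unit_col[OF that])
  qed
  have "(\<Sum>i<n. vec_index a i) = (\<Sum>j<m. vec_index b j)"
    using a b by (simp add: prob_simplex_def)
  from last_col_sum[OF row col this] row show ?thesis
    by (simp add: coupling_def gibbs_def)
qed

text \<open>In the free coordinates the gauge-constrained maximum is unconstrained, so all
  directional derivatives vanish there.\<close>

lemma argmax_coupling:
  assumes max: "is_arg_max (\<lambda>(\<alpha>', \<beta>'). dual_fun lam M a b \<alpha>' \<beta>') (\<lambda>x. x \<in> dual_vars n m) (\<alpha>, \<beta>)"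
  defines "z \<equiv> free_vars \<alpha> \<beta>"
  shows "z \<in> carrier_vec N" and "coupling n m (vec_index a) (vec_index b) (gibbs z)"
    and "scaled_kernel lam M \<alpha> \<beta> = Matrix.mat n m (\<lambda>(i, j). gibbs z i j)"
proof -
  have \<alpha>\<beta>: "\<alpha> \<in> carrier_vec n" "\<beta> \<in> carrier_vec m" "vec_index \<beta> (m - 1) = 0"
    using max by (auto simp: is_arg_max_linorder dual_vars_def)
  show z: "z \<in> carrier_vec N"
    using \<alpha>\<beta> by (auto simp: z_def free_vars_def N_def)
  have z_row: "vec_index z i = vec_index \<alpha> i" if "i < n" for i
    using \<alpha>\<beta> that by (simp add: z_def free_vars_def)
  have z_col: "col_pot z j = vec_index \<beta> j" if "j < m" for j
  proof (cases "j < m - 1")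
    case True
    thus ?thesis using \<alpha>\<beta> by (simp add: col_pot_def z_def free_vars_def vec_first_def)
  next
    case False
    hence "j = m - 1" using that by simp
    thus ?thesis using \<alpha>\<beta> by (simp add: col_pot_def)
  qed
  have "vec_first z n = \<alpha>"
    using \<alpha>\<beta> z by (auto simp: vec_first_def z_row)
  \<comment> \<open>The appended 0 restores the last entry of \<open>\<beta>\<close>, which is 0 by
    the gauge.\<close>
  moreover have "vec_last z (m - 1) @\<^sub>v 0\<^sub>v 1 = \<beta>"
  proof (rule eq_vecI)
    fix j assume "j < dim_vec \<beta>"
    hence j: "j < m" using \<alpha>\<beta> by simp
    show "vec_index (vec_last z (m - 1) @\<^sub>v 0\<^sub>v 1) j = vec_index \<beta> j"
      using z j z_col[OF j] by (auto simp: vec_last_def N_def col_pot_def)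
  qed (use \<alpha>\<beta> m_pos in auto)
  ultimately have Fz: "dual_fun_free lam M a b z = dual_fun lam M a b \<alpha> \<beta>"
    by (simp add: dual_fun_free_def)
  have max_le: "\<forall>p. p \<in> dual_vars n m \<longrightarrow>
      (case p of (\<alpha>', \<beta>') \<Rightarrow> dual_fun lam M a b \<alpha>' \<beta>') \<le> dual_fun lam M a b \<alpha> \<beta>"
    using max by (simp add: is_arg_max_linorder)
  have le: "dual_fun_free lam M a b w \<le> dual_fun_free lam M a b z" if "w \<in> carrier_vec N" for w
  proof -
    have "vec_last w (m - 1) @\<^sub>v 0\<^sub>v 1 \<in> carrier_vec m"
      by (rule carrier_vecI) (use m_pos in simp)
    moreover have "vec_index (vec_last w (m - 1) @\<^sub>v 0\<^sub>v 1) (m - 1) = 0" by simp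
    ultimately have "(vec_first w n, vec_last w (m - 1) @\<^sub>v 0\<^sub>v 1) \<in> dual_vars n m"
      by (simp add: dual_vars_def)
    from max_le[rule_format, OF this]
    have "dual_fun lam M a b (vec_first w n) (vec_last w (m - 1) @\<^sub>v 0\<^sub>v 1) \<le> dual_fun lam M a b \<alpha> \<beta>"
      by (simp only: prod.case)
    thus ?thesis
      unfolding Fz by (simp only: dual_fun_free_def dims)
  qed
  show "coupling n m (vec_index a) (vec_index b) (gibbs z)"
  proof (rule critical_point_coupling)
    fix k assume "k < N"
    have zero: "z + 0 \<cdot>\<^sub>v unit_vec N k = z"
      using z by auto
    \<comment> \<open>The maximum is global, so any radius works; 1 is chosen.\<close>
    have "margin (unit_vec N k) - (\<Sum>i<n. \<Sum>j<m. pot (unit_vec N k) i j * gibbs z i j) = 0"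
      by (rule DERIV_local_max[OF DERIV_dual_fun_free[OF z unit_vec_carrier], of 1])
        (use z in \<open>auto simp: zero intro!: le\<close>)
    thus "margin (unit_vec N k) = (\<Sum>i<n. \<Sum>j<m. pot (unit_vec N k) i j * gibbs z i j)"
      by simp
  qed
  show "scaled_kernel lam M \<alpha> \<beta> = Matrix.mat n m (\<lambda>(i, j). gibbs z i j)"
  proof (rule eq_matI)
    fix i j
    assume "i < dim_row (Matrix.mat n m (\<lambda>(i, j). gibbs z i j))"
      "j < dim_col (Matrix.mat n m (\<lambda>(i, j). gibbs z i j))"
    hence ij: "i < n" "j < m" by auto
    have "scaled_kernel lam M \<alpha> \<beta> $$ (i, j) =
        exp (lam * vec_index \<alpha> i) * exp (- lam * M $$ (i, j)) * exp (lam * vec_index \<beta> j)"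
      unfolding scaled_kernel_def carrier_vecD[OF \<alpha>\<beta>(1)] carrier_vecD[OF \<alpha>\<beta>(2)]
        mat_diag_mult_left[OF map_carrier_mat[THEN iffD2, OF M]] mat_diag_mult_right[OF mat_carrier]
      using ij by simp
    also have "\<dots> = gibbs z i j"
      by (simp add: gibbs_def z_row z_col ij algebra_simps flip: exp_add)
    finally show "scaled_kernel lam M \<alpha> \<beta> $$ (i, j) = Matrix.mat n m (\<lambda>(i, j). gibbs z i j) $$ (i, j)"
      using ij by simp
  qed (use \<alpha>\<beta> in \<open>auto simp: scaled_kernel_def mat_diag_def\<close>)
qed

section \<open>Directional derivative of the Sinkhorn distance\<close>

lemma eventually_in_simplex:
  assumes pos: "\<And>i. i < n \<Longrightarrow> 0 < vec_index a i" and v: "v \<in> tangent_simplex n"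
  shows "\<forall>\<^sub>F t in nhds 0. a + t \<cdot>\<^sub>v v \<in> prob_simplex n"
proof -
  have vc: "v \<in> carrier_vec n" "(\<Sum>i<n. vec_index v i) = 0"
    using v by (auto simp: tangent_simplex_def)
  have "((\<lambda>t. vec_index a i + t * vec_index v i) \<longlongrightarrow> vec_index a i + 0 * vec_index v i) (nhds 0)" for i
    by (intro tendsto_intros filterlim_ident)
  hence "\<forall>\<^sub>F t in nhds 0. \<forall>i\<in>{..<n}. 0 < vec_index a i + t * vec_index v i"
    using pos by (intro eventually_ball_finite ballI order_tendstoD(1)) auto
  thus ?thesis
  proof (rule eventually_mono)
    fix t assume "\<forall>i\<in>{..<n}. 0 < vec_index a i + t * vec_index v i"
    thus "a + t \<cdot>\<^sub>v v \<in> prob_simplex n"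
      using vc a by (auto simp: prob_simplex_def sum.distrib less_imp_le simp flip: sum_distrib_left)
  qed
qed

text \<open>Along \<open>w\<close> the marginals of the Gibbs kernel change at rate
  \<open>- H w\<close>, where \<open>H\<close> is the dual Hessian. Thus \<open>Hw\<close> says that
  the row marginal follows \<open>v\<close> while the free column marginals stay fixed.\<close>

lemma DERIV_sharp_sinkhorn:
  assumes z: "z \<in> carrier_vec N" and T: "coupling n m (vec_index a) (vec_index b) (gibbs z)"
    and v: "v \<in> tangent_simplex n" and w: "w \<in> carrier_vec N"
    and Hw: "hessian (dual_fun_free lam M a b) z *\<^sub>v w = - (v @\<^sub>v 0\<^sub>v (m - 1))"
  shows "((\<lambda>t. sharp_sinkhorn lam M (a + t \<cdot>\<^sub>v v) b) has_real_derivative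
    lam * (\<Sum>i<n. \<Sum>j<m. pot w i j * (gibbs z i j * M $$ (i, j)))) (at 0)"
proof -
  let ?dT = "\<lambda>i j. lam * gibbs z i j * (vec_index w i + col_pot w j)"
  let ?P = "\<lambda>t i j. sinkhorn_plan lam M (a + t \<cdot>\<^sub>v v) b $$ (i, j)"
  let ?cost = "\<lambda>i j. M $$ (i, j)"
  have vc: "v \<in> carrier_vec n" "(\<Sum>i<n. vec_index v i) = 0"
    using v by (auto simp: tangent_simplex_def)
  have dT: "?dT i j = lam * (pot w i j * gibbs z i j)" for i j
    by (simp add: pot_def)
  have row: "(\<Sum>j<m. ?dT i j) = vec_index v i" if "i < n" for i
    using hessian_mult_vec[OF z w less_N[OF that]] that vc unfolding Hw
    by (simp add: sum_pot_unit_row less_N dT flip: sum_distrib_left)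
  have col': "(\<Sum>i<n. ?dT i j) = 0" if "j < m - 1" for j
  proof -
    have k: "n + j < N" using that by (simp add: N_def)
    show ?thesis
      using hessian_mult_vec[OF z w k] that vc k lam unfolding Hw
      by (simp add: sum_pot_unit_col[OF that] dT flip: sum_distrib_left)
  qed
  have col: "(\<Sum>i<n. ?dT i j) = 0" if "j < m" for j
    by (rule last_col_sum[OF row col']) (use vc that in auto)
  \<comment> \<open>Rows of the Gibbs coupling have positive entries, so \<open>a\<close> is
    interior and both signs of \<open>t\<close> are admissible.\<close>
  have pos: "0 < vec_index a i" if "i < n" for i
  proof -
    have "0 < (\<Sum>j<m. gibbs z i j)"
      using m_pos by (intro sum_pos) (auto simp: gibbs_def)
    thus ?thesis using T that by (simp add: coupling_def)
  qed
  note simplex = eventually_in_simplex[OF pos v]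
  have coupling_eq: "coupling n m (vec_index (a + t \<cdot>\<^sub>v v)) =
      coupling n m (\<lambda>i. vec_index a i + t * vec_index v i)" for t
    using vc by (auto simp: fun_eq_iff coupling_def)
  have min: "\<forall>\<^sub>F t in nhds 0. coupling n m (\<lambda>i. vec_index a i + t * vec_index v i) (vec_index b) (?P t) \<and>
      (\<forall>Z. coupling n m (\<lambda>i. vec_index a i + t * vec_index v i) (vec_index b) Z \<longrightarrow>
         reg_cost n m lam ?cost (?P t) \<le> reg_cost n m lam ?cost Z)"
    using simplex
  proof (rule eventually_mono)
    fix t assume t: "a + t \<cdot>\<^sub>v v \<in> prob_simplex n"
    show "coupling n m (\<lambda>i. vec_index a i + t * vec_index v i) (vec_index b) (?P t) \<and>
      (\<forall>Z. coupling n m (\<lambda>i. vec_index a i + t * vec_index v i) (vec_index b) Z \<longrightarrow>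
         reg_cost n m lam ?cost (?P t) \<le> reg_cost n m lam ?cost Z)"
      using sinkhorn_plan_minimizer(2,3)[OF lam M t b] unfolding coupling_eq by blast
  qed
  have mass: "(\<Sum>i<n. vec_index a i) = 1"
    using a by (simp add: prob_simplex_def)
  have "((\<lambda>t. ?P t i j) has_real_derivative ?dT i j) (at 0)" if "i < n" "j < m" for i j
    using minimizer_DERIV[OF lam n_pos m_pos T[unfolded gibbs_def] mass
        row[unfolded gibbs_def] col[unfolded gibbs_def] min that]
    unfolding gibbs_def .
  hence "((\<lambda>t. \<Sum>i<n. \<Sum>j<m. ?P t i j * M $$ (i, j)) has_real_derivative
      (\<Sum>i<n. \<Sum>j<m. ?dT i j * M $$ (i, j))) (at 0)"
    by (intro DERIV_sum DERIV_cmult_right) auto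
  \<comment> \<open>The plan is known to be an \<open>n\<close> by \<open>m\<close> matrix only when
    \<open>a + t v\<close> lies in the simplex, hence the equality near 0 only.\<close>
  moreover have "\<forall>\<^sub>F t in nhds 0. sharp_sinkhorn lam M (a + t \<cdot>\<^sub>v v) b =
      (\<Sum>i<n. \<Sum>j<m. ?P t i j * M $$ (i, j))"
    using simplex
  proof (rule eventually_mono)
    fix t assume t: "a + t \<cdot>\<^sub>v v \<in> prob_simplex n"
    show "sharp_sinkhorn lam M (a + t \<cdot>\<^sub>v v) b = (\<Sum>i<n. \<Sum>j<m. ?P t i j * M $$ (i, j))"
      unfolding sharp_sinkhorn_def
      by (rule mat_inner_eq_sum[OF sinkhorn_plan_minimizer(1)[OF lam M t b] M])
  qed
  ultimately have "((\<lambda>t. sharp_sinkhorn lam M (a + t \<cdot>\<^sub>v v) b) has_real_derivative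
      (\<Sum>i<n. \<Sum>j<m. ?dT i j * M $$ (i, j))) (at 0)"
    by (rule iffD2[OF DERIV_cong_ev[OF refl _ refl], rotated])
  moreover have "(\<Sum>i<n. \<Sum>j<m. ?dT i j * M $$ (i, j)) =
      lam * (\<Sum>i<n. \<Sum>j<m. pot w i j * (gibbs z i j * M $$ (i, j)))"
    by (simp add: pot_def sum_distrib_left mult_ac)
  ultimately show ?thesis by simp
qed

section \<open>Assembling the matrix formula for the gradient\<close>

lemma marginals_scalar_prod:
  assumes L: "L \<in> carrier_mat n m" and w: "w \<in> carrier_vec N"
  shows "((L *\<^sub>v ones_vec m) @\<^sub>v ((drop_last_col L)\<^sup>T *\<^sub>v ones_vec n)) \<bullet> w =
    (\<Sum>i<n. \<Sum>j<m. pot w i j * L $$ (i, j))"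
proof -
  have "((L *\<^sub>v ones_vec m) @\<^sub>v ((drop_last_col L)\<^sup>T *\<^sub>v ones_vec n)) \<bullet> w =
    (\<Sum>k<N. vec_index ((L *\<^sub>v ones_vec m) @\<^sub>v ((drop_last_col L)\<^sup>T *\<^sub>v ones_vec n)) k * vec_index w k)"
    using w by (simp add: scalar_prod_def lessThan_atLeast0)
  also have "\<dots> = (\<Sum>i<n. (\<Sum>j<m. L $$ (i, j)) * vec_index w i) +
      (\<Sum>j<m - 1. (\<Sum>i<n. L $$ (i, j)) * vec_index w (n + j))"
    using L unfolding sum_N
    by (simp add: drop_last_col_def ones_vec_def scalar_prod_def lessThan_atLeast0)
  \<comment> \<open>Adding the last column back contributes 0, since its potential is 0 by the
    gauge.\<close>
  also have "(\<Sum>j<m - 1. (\<Sum>i<n. L $$ (i, j)) * vec_index w (n + j)) =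
      (\<Sum>j<m. (\<Sum>i<n. L $$ (i, j)) * col_pot w j)"
    by (simp add: sum_cols col_pot_def)
  also have "\<dots> = (\<Sum>i<n. \<Sum>j<m. L $$ (i, j) * col_pot w j)"
    unfolding sum_distrib_right by (rule sum.swap)
  finally show ?thesis
    by (simp add: pot_def sum_distrib_left sum_distrib_right sum.distrib algebra_simps)
qed

text \<open>\<open>[A B]\<close> applied to the stacked vector is \<open>- lam * D K (x, y)\<close>,
  and the transpose of \<open>D\<close> sends \<open>v\<close> to \<open>(v, 0)\<close>.\<close>

lemma block_gradient_scalar_prod:
  assumes A: "A \<in> carrier_mat n n" and B: "B \<in> carrier_mat n (m - 1)" and K: "K \<in> carrier_mat N N"
    and AB: "append_cols A B = (- lam) \<cdot>\<^sub>m (append_cols (1\<^sub>m n) (0\<^sub>m n (m - 1)) * K)"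
    and x: "x \<in> carrier_vec n" and y: "y \<in> carrier_vec (m - 1)" and v: "v \<in> carrier_vec n"
  shows "(A *\<^sub>v x + B *\<^sub>v y) \<bullet> v = - lam * ((K *\<^sub>v (x @\<^sub>v y)) \<bullet> (v @\<^sub>v 0\<^sub>v (m - 1)))"
proof -
  let ?D = "append_cols (1\<^sub>m n) (0\<^sub>m n (m - 1)) :: real mat"
  have idx: "append_cols X Y $$ (i, k) = (if k < n then X $$ (i, k) else Y $$ (i, k - n))"
    if "X \<in> carrier_mat n n" "Y \<in> carrier_mat n (m - 1)" "i < n" "k < N" for X Y :: "real mat" and i k
    using that by (auto simp: append_cols_def N_def)
  have entry: "vec_index (A *\<^sub>v x + B *\<^sub>v y) i = - lam * vec_index (K *\<^sub>v (x @\<^sub>v y)) i"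
    if i: "i < n" for i
  proof -
    \<comment> \<open>Multiplication by \<open>D\<close> from the left keeps the first
      \<open>n\<close> rows of \<open>K\<close>.\<close>
    have D: "(?D * K) $$ (i, k) = K $$ (i, k)" if k: "k < N" for k
    proof -
      have "(?D * K) $$ (i, k) = (\<Sum>l<N. ?D $$ (i, l) * K $$ (l, k))"
        using K i k by (simp add: scalar_prod_def lessThan_atLeast0 append_cols_def N_def)
      also have "\<dots> = (\<Sum>l<N. if l = i then K $$ (l, k) else 0)"
        using i by (intro sum.cong) (auto simp: idx N_def)
      finally show ?thesis using i by (simp add: sum.delta N_def)
    qed
    have "vec_index (A *\<^sub>v x + B *\<^sub>v y) i =
        (\<Sum>k<N. append_cols A B $$ (i, k) * vec_index (x @\<^sub>v y) k)"
      using A B x y i unfolding sum_N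
      by (simp add: idx N_def scalar_prod_def lessThan_atLeast0)
    also have "\<dots> = (\<Sum>k<N. - lam * (K $$ (i, k) * vec_index (x @\<^sub>v y) k))"
      using i K D unfolding AB by (intro sum.cong refl) (simp add: append_cols_def N_def)
    also have "\<dots> = - lam * vec_index (K *\<^sub>v (x @\<^sub>v y)) i"
      using i K x y by (simp add: scalar_prod_def lessThan_atLeast0 N_def sum_distrib_left)
    finally show ?thesis .
  qed
  have "(K *\<^sub>v (x @\<^sub>v y)) \<bullet> (v @\<^sub>v 0\<^sub>v (m - 1)) = (\<Sum>k<N. vec_index (K *\<^sub>v (x @\<^sub>v y)) k * vec_index (v @\<^sub>v 0\<^sub>v (m - 1)) k)"
    using v by (simp add: scalar_prod_def lessThan_atLeast0 N_def)
  also have "\<dots> = (\<Sum>i<n. vec_index (K *\<^sub>v (x @\<^sub>v y)) i * vec_index v i)"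
    using v unfolding sum_N by simp
  finally show ?thesis
    using v by (simp add: scalar_prod_def[of _ v] lessThan_atLeast0[symmetric] entry sum_distrib_left mult.assoc del: index_add_vec)
qed

text \<open>An adjoint argument: the derivative along \<open>v\<close> uses
  \<open>w = - K (v, 0)\<close>, whereas the formula applies \<open>K\<close> once to the marginals
  of \<open>L\<close>. Symmetry of the Hessian exchanges the two.\<close>

lemma sinkhorn_gradient:
  assumes z: "z \<in> carrier_vec N" and T: "coupling n m (vec_index a) (vec_index b) (gibbs z)"
    and K: "K \<in> carrier_mat N N" "hessian (dual_fun_free lam M a b) z * K = 1\<^sub>m N"
    and A: "A \<in> carrier_mat n n" and B: "B \<in> carrier_mat n (m - 1)"
    and AB: "append_cols A B = (- lam) \<cdot>\<^sub>m (append_cols (1\<^sub>m n) (0\<^sub>m n (m - 1)) * K)"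
    and L: "L = hadamard (Matrix.mat n m (\<lambda>(i, j). gibbs z i j)) M"
  shows "has_simplex_gradient (\<lambda>a'. sharp_sinkhorn lam M a' b) a
    (orth_proj (tangent_simplex n)
      (A *\<^sub>v (L *\<^sub>v ones_vec m) + B *\<^sub>v ((drop_last_col L)\<^sup>T *\<^sub>v ones_vec n)))"
proof -
  let ?H = "hessian (dual_fun_free lam M a b) z"
  let ?x = "L *\<^sub>v ones_vec m" and ?y = "(drop_last_col L)\<^sup>T *\<^sub>v ones_vec n"
  let ?g = "A *\<^sub>v ?x + B *\<^sub>v ?y"
  have H: "?H \<in> carrier_mat N N" by (rule hessian_carrier[OF z])
  have Lc: "L \<in> carrier_mat n m" by (simp add: L hadamard_def)
  have x: "?x \<in> carrier_vec n" and y: "?y \<in> carrier_vec (m - 1)"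
    by (rule carrier_vecI, use Lc in \<open>simp add: drop_last_col_def\<close>)+
  have p: "?x @\<^sub>v ?y \<in> carrier_vec N" unfolding N_def by (rule append_carrier_vec[OF x y])
  have g: "?g \<in> carrier_vec n" by (rule carrier_vecI) (use B in simp)
  have HK: "?H *\<^sub>v (K *\<^sub>v u) = u" if "u \<in> carrier_vec N" for u
    using that H K by (simp flip: assoc_mult_mat_vec[OF H K(1)])
  have "((\<lambda>t. sharp_sinkhorn lam M (a + t \<cdot>\<^sub>v v) b) has_real_derivative ?g \<bullet> v) (at 0)"
    if v: "v \<in> tangent_simplex n" for v
  proof -
    let ?v = "v @\<^sub>v 0\<^sub>v (m - 1)"
    have vc: "v \<in> carrier_vec n" using v by (simp add: tangent_simplex_def)
    hence vN: "?v \<in> carrier_vec N" by (simp add: N_def)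
    define w where "w = K *\<^sub>v (- ?v)"
    define q where "q = K *\<^sub>v (?x @\<^sub>v ?y)"
    have w: "w \<in> carrier_vec N" and q: "q \<in> carrier_vec N"
      by (rule carrier_vecI, use K in \<open>simp add: w_def q_def\<close>)+
    have Hw: "?H *\<^sub>v w = - ?v"
      using vN by (simp add: w_def HK)
    have Hq: "?H *\<^sub>v q = ?x @\<^sub>v ?y"
      unfolding q_def by (rule HK[OF p])
    \<comment> \<open>Both \<open>w\<close> and \<open>q\<close> are images under \<open>K\<close>,
      so applying the Hessian recovers \<open>- (v, 0)\<close> and the marginals of
      \<open>L\<close>.\<close>
    have "q \<bullet> ?v = - ((?H *\<^sub>v w) \<bullet> q)"
      unfolding Hw comm_scalar_prod[OF q vN] by (simp only: uminus_scalar_prod[OF vN q, symmetric] minus_minus)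
    also have "(?H *\<^sub>v w) \<bullet> q = (?H *\<^sub>v q) \<bullet> w"
      unfolding hessian_quadratic_form[OF z w q] hessian_quadratic_form[OF z q w]
      by (simp add: mult.left_commute)
    also have "\<dots> = (\<Sum>i<n. \<Sum>j<m. pot w i j * L $$ (i, j))"
      unfolding Hq by (rule marginals_scalar_prod[OF Lc w])
    finally have "?g \<bullet> v = lam * (\<Sum>i<n. \<Sum>j<m. pot w i j * L $$ (i, j))"
      using block_gradient_scalar_prod[OF A B K(1) AB x y vc] by (simp add: q_def)
    also have "\<dots> = lam * (\<Sum>i<n. \<Sum>j<m. pot w i j * (gibbs z i j * M $$ (i, j)))"
      by (simp add: L hadamard_def)
    finally show ?thesis
      using DERIV_sharp_sinkhorn[OF z T v w Hw] by simp
  qed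
  thus ?thesis
    using orth_proj_tangent_simplex[OF g n_pos] by (simp add: has_simplex_gradient_def)
qed

end

text \<open>Invertibility of the Hessian is part of the conclusion, and the concatenation equation
  pins down \<open>A\<close> and \<open>B\<close> as blocks.\<close>

theorem theorem3:
  fixes n m :: nat and M :: "real mat" and a b \<alpha> \<beta> :: "real Matrix.vec" and lam :: real
  assumes "M \<in> carrier_mat n m" and "a \<in> prob_simplex n" and "b \<in> prob_simplex m" and "lam > 0"
    and "is_arg_max (\<lambda>(\<alpha>', \<beta>'). dual_fun lam M a b \<alpha>' \<beta>') (\<lambda>x. x \<in> dual_vars n m) (\<alpha>, \<beta>)"
  shows "\<exists>K. mat_inverse (hessian (dual_fun_free lam M a b) (free_vars \<alpha> \<beta>)) = Some K \<and>
    (\<forall>A \<in> carrier_mat n n. \<forall>B \<in> carrier_mat n (m - 1).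
      append_cols A B = (- lam) \<cdot>\<^sub>m (append_cols (1\<^sub>m n) (0\<^sub>m n (m - 1)) * K) \<longrightarrow>
      (let L = hadamard (scaled_kernel lam M \<alpha> \<beta>) M in
        has_simplex_gradient (\<lambda>a'. sharp_sinkhorn lam M a' b) a
          (orth_proj (tangent_simplex n)
            (A *\<^sub>v (L *\<^sub>v ones_vec m) + B *\<^sub>v ((drop_last_col L)\<^sup>T *\<^sub>v ones_vec n)))))"
proof -
  interpret sinkhorn_data n m M a b lam
    by (unfold_locales) (fact assms)+
  note z = argmax_coupling[OF assms(5)]
  obtain K where K: "mat_inverse (hessian (dual_fun_free lam M a b) (free_vars \<alpha> \<beta>)) = Some K"
    "hessian (dual_fun_free lam M a b) (free_vars \<alpha> \<beta>) * K = 1\<^sub>m N" "K \<in> carrier_mat N N"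
    by (rule hessian_invertible[OF z(1)])
  show ?thesis
    unfolding Let_def z(3)
    using K sinkhorn_gradient[OF z(1,2) K(3,2) _ _ _ refl] by blast
qed

end
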